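(* Let $R$ be a commutative ring with identity and let $\boldsymbol{M}$ be an $\mathbb{N}^r$-graded $R[x_1,\ldots,x_r]$-module. Then $\boldsymbol{M}$ is isomorphic (as an $\mathbb{N}^r$-graded module) to the module $\boldsymbol{RF}$ associated with the $R$-span of some multifiltration of sets $F\colon\mathbb{N}^r\to\mathrm{Sets}$ if and only if $\boldsymbol{M}$ is isomorphic to a direct sum of monomial ideals in $R[x_1,\ldots,x_r]$.
   Context: $\mathbb{N}=\{0,1,2,\ldots\}$ and $\mathbb{N}^r$ is the poset of $r$-tuples of natural numbers with the componentwise order, viewed as a category. A multifiltration of sets is a functor $F\colon\mathbb{N}^r\to\mathrm{Sets}$ such that $F(v\leq w)$ is injective for all $v\leq w$. The $R$-span functor $R\colon\mathrm{Sets}\to R\text{-}\mathrm{Mod}$ sends a set $S$ to the free module $R(S)=\bigoplus_S R$; $RF\colon\mathbb{N}^r\to R\text{-}\mathrm{Mod}$ is the composite of $F$ with it. A functor $G\colon\mathbb{N}^r\to R\text{-}\mathrm{Mod}$ is identified with the $\mathbb{N}^r$-graded $R[x_1,\ldots,x_r]$-module $\boldsymbol{G}=\bigoplus_{v\in\mathbb{N}^r}G(v)$, where $x_i$ acts on the component $G(v)$ via $G(v\leq v+e_i)$, with $e_i$ the $i$-th standard basis vector; this is an equivalence of categories. Morphisms of graded modules are degree-preserving homomorphisms. The monomial $x^v=x_1^{v_1}\cdots x_r^{v_r}$ has grade $v$. A monomial ideal is an ideal of $R[x_1,\ldots,x_r]$ generated by monomials, with its induced $\mathbb{N}^r$-grading.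 Direct sums may be indexed by arbitrary sets. *)

theory Defs
  imports "HOL-Algebra.Algebra" "HOL-Library.Function_Algebras"
begin

text \<open>
  The poset \<open>\<nat>\<^sup>r\<close>: functions on the indices \<open>0, \<dots>, r - 1\<close>, padded with zeros, so that the
  library's pointwise \<open>\<le>\<close>, \<open>+\<close> and \<open>-\<close> on \<open>nat \<Rightarrow> nat\<close> are the componentwise ones.
\<close>

definition expos :: "nat \<Rightarrow> (nat \<Rightarrow> nat) set" where
  "expos r = {v. \<forall>i\<ge>r. v i = 0}"


section \<open>The polynomial ring in \<open>r\<close> variables\<close>

text \<open>A polynomial is the function sending an exponent vector to its coefficient.\<close>

definition mpoly_ring :: "('a, 'z) ring_scheme \<Rightarrow> nat \<Rightarrow> ((nat \<Rightarrow> nat) \<Rightarrow> 'a) ring" where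
  "mpoly_ring R r =
    \<lparr> carrier = {p. (\<forall>v. p v \<in> carrier R) \<and> (\<forall>v. v \<notin> expos r \<longrightarrow> p v = \<zero>\<^bsub>R\<^esub>) \<and>
                    finite {v. p v \<noteq> \<zero>\<^bsub>R\<^esub>}},
      monoid.mult = (\<lambda>p q v. if v \<in> expos r
                      then \<Oplus>\<^bsub>R\<^esub>u\<in>{u. u \<le> v}. p u \<otimes>\<^bsub>R\<^esub> q (v - u) else \<zero>\<^bsub>R\<^esub>),
      one = (\<lambda>v. if v = 0 then \<one>\<^bsub>R\<^esub> else \<zero>\<^bsub>R\<^esub>),
      ring.zero = (\<lambda>v. \<zero>\<^bsub>R\<^esub>),
      add = (\<lambda>p q v. p v \<oplus>\<^bsub>R\<^esub> q v) \<rparr>"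

definition monomial :: "('a, 'z) ring_scheme \<Rightarrow> (nat \<Rightarrow> nat) \<Rightarrow> (nat \<Rightarrow> nat) \<Rightarrow> 'a" where
  "monomial R v = (\<lambda>u. if u = v then \<one>\<^bsub>R\<^esub> else \<zero>\<^bsub>R\<^esub>)"

definition homogeneous_part :: "('a, 'z) ring_scheme \<Rightarrow> nat \<Rightarrow> (nat \<Rightarrow> nat) \<Rightarrow> ((nat \<Rightarrow> nat) \<Rightarrow> 'a) set" where
  "homogeneous_part R r v = {p \<in> carrier (mpoly_ring R r). \<forall>u. u \<noteq> v \<longrightarrow> p u = \<zero>\<^bsub>R\<^esub>}"


section \<open>Graded modules\<close>

record ('p, 'm) gmodule = "('p, 'm) module" +
  piece :: "(nat \<Rightarrow> nat) \<Rightarrow> 'm set"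

text \<open>
  The field \<open>piece\<close> is meaningful on \<open>\<nat>\<^sup>r\<close> only. The last clause but one says that the module is
  the internal direct sum of its pieces.
\<close>

definition graded_module ::
  "('a, 'z) ring_scheme \<Rightarrow> nat \<Rightarrow> ((nat \<Rightarrow> nat) \<Rightarrow> 'a, 'm) gmodule \<Rightarrow> bool" where
  "graded_module R r M \<longleftrightarrow>
     module (mpoly_ring R r) M \<and>
     (\<forall>v\<in>expos r. subgroup (piece M v) (add_monoid M)) \<and>
     (\<forall>m\<in>carrier M. \<exists>!f. f \<in> (\<Pi>\<^sub>E v\<in>expos r. piece M v) \<and>
        finite {v \<in> expos r. f v \<noteq> \<zero>\<^bsub>M\<^esub>} \<and>
        m = (\<Oplus>\<^bsub>M\<^esub>v\<in>{v \<in> expos r. f v \<noteq> \<zero>\<^bsub>M\<^esub>}. f v)) \<and>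
     (\<forall>u\<in>expos r. \<forall>v\<in>expos r. \<forall>p\<in>homogeneous_part R r u. \<forall>m\<in>piece M v.
        p \<odot>\<^bsub>M\<^esub> m \<in> piece M (u + v))"

definition graded_hom ::
  "('a, 'z) ring_scheme \<Rightarrow> nat \<Rightarrow> ((nat \<Rightarrow> nat) \<Rightarrow> 'a, 'm) gmodule \<Rightarrow>
   ((nat \<Rightarrow> nat) \<Rightarrow> 'a, 'n) gmodule \<Rightarrow> ('m \<Rightarrow> 'n) set" where
  "graded_hom R r M N =
    {\<phi>. \<phi> \<in> carrier M \<rightarrow> carrier N \<and>
        (\<forall>x\<in>carrier M. \<forall>y\<in>carrier M. \<phi> (x \<oplus>\<^bsub>M\<^esub> y) = \<phi> x \<oplus>\<^bsub>N\<^esub> \<phi> y) \<and>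
        (\<forall>p\<in>carrier (mpoly_ring R r). \<forall>x\<in>carrier M. \<phi> (p \<odot>\<^bsub>M\<^esub> x) = p \<odot>\<^bsub>N\<^esub> \<phi> x) \<and>
        (\<forall>v\<in>expos r. \<phi> ` piece M v \<subseteq> piece N v)}"

definition graded_iso ::
  "('a, 'z) ring_scheme \<Rightarrow> nat \<Rightarrow> ((nat \<Rightarrow> nat) \<Rightarrow> 'a, 'm) gmodule \<Rightarrow>
   ((nat \<Rightarrow> nat) \<Rightarrow> 'a, 'n) gmodule \<Rightarrow> bool" where
  "graded_iso R r M N \<longleftrightarrow>
     (\<exists>\<phi>\<in>graded_hom R r M N. \<exists>\<psi>\<in>graded_hom R r N M.
        (\<forall>x\<in>carrier M. \<psi> (\<phi> x) = x) \<and> (\<forall>y\<in>carrier N. \<phi> (\<psi> y) = y))"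


section \<open>Direct sums\<close>

text \<open>The ring multiplication and unit of a module record carry no information.\<close>

definition direct_sum :: "'i set \<Rightarrow> ('i \<Rightarrow> ('p, 'm, 'z) module_scheme) \<Rightarrow> ('p, 'i \<Rightarrow> 'm) module" where
  "direct_sum I N =
    \<lparr> carrier = carrier (sum_group I (\<lambda>i. add_monoid (N i))),
      monoid.mult = undefined, one = undefined,
      ring.zero = \<one>\<^bsub>sum_group I (\<lambda>i. add_monoid (N i))\<^esub>,
      add = monoid.mult (sum_group I (\<lambda>i. add_monoid (N i))),
      smult = (\<lambda>a f. \<lambda>i\<in>I. a \<odot>\<^bsub>N i\<^esub> f i) \<rparr>"

definition graded_direct_sum :: "'i set \<Rightarrow> ('i \<Rightarrow> ('p, 'm) gmodule) \<Rightarrow> ('p, 'i \<Rightarrow> 'm) gmodule" where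
  "graded_direct_sum I N =
     module.extend (direct_sum I N)
       \<lparr> piece = (\<lambda>v. {f \<in> carrier (direct_sum I N). \<forall>i\<in>I. f i \<in> piece (N i) v}) \<rparr>"


section \<open>Monomial ideals\<close>

definition monomial_ideal ::
  "('a, 'z) ring_scheme \<Rightarrow> nat \<Rightarrow> ((nat \<Rightarrow> nat) \<Rightarrow> 'a) set \<Rightarrow> bool" where
  "monomial_ideal R r J \<longleftrightarrow> (\<exists>V\<subseteq>expos r. J = Idl\<^bsub>mpoly_ring R r\<^esub> (monomial R ` V))"

definition ideal_gmodule ::
  "('a, 'z) ring_scheme \<Rightarrow> nat \<Rightarrow> ((nat \<Rightarrow> nat) \<Rightarrow> 'a) set \<Rightarrow>
   ((nat \<Rightarrow> nat) \<Rightarrow> 'a, (nat \<Rightarrow> nat) \<Rightarrow> 'a) gmodule" where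
  "ideal_gmodule R r J =
    \<lparr> carrier = J, monoid.mult = undefined, one = undefined,
      ring.zero = \<zero>\<^bsub>mpoly_ring R r\<^esub>, add = add (mpoly_ring R r), smult = monoid.mult (mpoly_ring R r),
      piece = (\<lambda>v. J \<inter> homogeneous_part R r v) \<rparr>"


section \<open>Multifiltrations and their spans\<close>

text \<open>
  A functor on \<open>\<nat>\<^sup>r\<close> is given by its values on objects and its transition maps; \<open>T v w\<close> is the
  value on the arrow \<open>v \<le> w\<close>.
\<close>

definition set_functor ::
  "nat \<Rightarrow> ((nat \<Rightarrow> nat) \<Rightarrow> 's set) \<Rightarrow> ((nat \<Rightarrow> nat) \<Rightarrow> (nat \<Rightarrow> nat) \<Rightarrow> 's \<Rightarrow> 's) \<Rightarrow> bool" where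
  "set_functor r F T \<longleftrightarrow>
     (\<forall>v\<in>expos r. \<forall>w\<in>expos r. v \<le> w \<longrightarrow> T v w \<in> F v \<rightarrow> F w) \<and>
     (\<forall>v\<in>expos r. \<forall>s\<in>F v. T v v s = s) \<and>
     (\<forall>u\<in>expos r. \<forall>v\<in>expos r. \<forall>w\<in>expos r. u \<le> v \<longrightarrow> v \<le> w \<longrightarrow>
        (\<forall>s\<in>F u. T v w (T u v s) = T u w s))"

definition multifiltration ::
  "nat \<Rightarrow> ((nat \<Rightarrow> nat) \<Rightarrow> 's set) \<Rightarrow> ((nat \<Rightarrow> nat) \<Rightarrow> (nat \<Rightarrow> nat) \<Rightarrow> 's \<Rightarrow> 's) \<Rightarrow> bool" where
  "multifiltration r F T \<longleftrightarrow> set_functor r F T \<and>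
     (\<forall>v\<in>expos r. \<forall>w\<in>expos r. v \<le> w \<longrightarrow> inj_on (T v w) (F v))"

definition regular_module :: "('a, 'z) ring_scheme \<Rightarrow> ('a, 'a) module" where
  "regular_module R =
    \<lparr> carrier = carrier R, monoid.mult = monoid.mult R, one = one R, ring.zero = ring.zero R, add = add R,
      smult = monoid.mult R \<rparr>"

definition free_module :: "('a, 'z) ring_scheme \<Rightarrow> 's set \<Rightarrow> ('a, 's \<Rightarrow> 'a) module" where
  "free_module R S = direct_sum S (\<lambda>_. regular_module R)"

text \<open>
  The \<open>R\<close>-span functor on a map \<open>t : S \<rightarrow> S'\<close>: the linear extension of \<open>t\<close>, pushing coefficients
  forward. The sum is restricted to the support because \<open>finsum\<close> needs a finite index set.
\<close>

definition free_map ::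
  "('a, 'z) ring_scheme \<Rightarrow> 's set \<Rightarrow> 't set \<Rightarrow> ('s \<Rightarrow> 't) \<Rightarrow> ('s \<Rightarrow> 'a) \<Rightarrow> ('t \<Rightarrow> 'a)" where
  "free_map R S S' t f = (\<lambda>y\<in>S'. \<Oplus>\<^bsub>R\<^esub>x\<in>{x \<in> S. t x = y \<and> f x \<noteq> \<zero>\<^bsub>R\<^esub>}. f x)"

text \<open>
  The graded module \<open>\<Oplus>\<^sub>v G v\<close> of a functor \<open>G\<close> from \<open>\<nat>\<^sup>r\<close> to \<open>R\<close>-modules with transition maps
  \<open>t\<close>. Since \<open>x\<^sub>i\<close> acts on \<open>G v\<close> by the map for \<open>v \<le> v + e\<^sub>i\<close>, functoriality makes \<open>x\<^sup>u\<close> act by the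
  map for \<open>v \<le> v + u\<close>; the component of \<open>p f\<close> in degree \<open>w\<close> collects these over all \<open>u + v = w\<close>.
\<close>

definition functor_gmodule ::
  "nat \<Rightarrow> ((nat \<Rightarrow> nat) \<Rightarrow> ('a, 'm) module) \<Rightarrow>
   ((nat \<Rightarrow> nat) \<Rightarrow> (nat \<Rightarrow> nat) \<Rightarrow> 'm \<Rightarrow> 'm) \<Rightarrow>
   ((nat \<Rightarrow> nat) \<Rightarrow> 'a, (nat \<Rightarrow> nat) \<Rightarrow> 'm) gmodule" where
  "functor_gmodule r G t =
    \<lparr> carrier = carrier (direct_sum (expos r) G), monoid.mult = undefined, one = undefined,
      ring.zero = ring.zero (direct_sum (expos r) G), add = add (direct_sum (expos r) G),
      smult = (\<lambda>p f. \<lambda>w\<in>expos r.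
                 \<Oplus>\<^bsub>G w\<^esub>u\<in>{u. u \<le> w}. p u \<odot>\<^bsub>G w\<^esub> t (w - u) w (f (w - u))),
      piece = (\<lambda>v. {f \<in> carrier (direct_sum (expos r) G).
                      \<forall>w\<in>expos r. w \<noteq> v \<longrightarrow> f w = \<zero>\<^bsub>G w\<^esub>}) \<rparr>"

definition span_gmodule ::
  "('a, 'z) ring_scheme \<Rightarrow> nat \<Rightarrow> ((nat \<Rightarrow> nat) \<Rightarrow> 's set) \<Rightarrow>
   ((nat \<Rightarrow> nat) \<Rightarrow> (nat \<Rightarrow> nat) \<Rightarrow> 's \<Rightarrow> 's) \<Rightarrow>
   ((nat \<Rightarrow> nat) \<Rightarrow> 'a, (nat \<Rightarrow> nat) \<Rightarrow> 's \<Rightarrow> 'a) gmodule" where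
  "span_gmodule R r F T =
     functor_gmodule r (\<lambda>v. free_module R (F v)) (\<lambda>v w. free_map R (F v) (F w) (T v w))"


section \<open>The two properties\<close>

text \<open>
  The type argument bounds the sets of the multifiltration, respectively the index set of the
  direct sum, because HOL has no quantification over types inside a formula.
\<close>

definition iso_to_span ::
  "'s itself \<Rightarrow> ('a, 'z) ring_scheme \<Rightarrow> nat \<Rightarrow> ((nat \<Rightarrow> nat) \<Rightarrow> 'a, 'm) gmodule \<Rightarrow> bool" where
  "iso_to_span _ R r M \<longleftrightarrow>
     (\<exists>(F :: (nat \<Rightarrow> nat) \<Rightarrow> 's set) T. multifiltration r F T \<and> graded_iso R r M (span_gmodule R r F T))"

definition iso_to_sum_of_monomial_ideals ::
  "'i itself \<Rightarrow> ('a, 'z) ring_scheme \<Rightarrow> nat \<Rightarrow> ((nat \<Rightarrow> nat) \<Rightarrow> 'a, 'm) gmodule \<Rightarrow> bool" where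
  "iso_to_sum_of_monomial_ideals _ R r M \<longleftrightarrow>
     (\<exists>(I :: 'i set) J. (\<forall>i\<in>I. monomial_ideal R r (J i)) \<and>
        graded_iso R r M (graded_direct_sum I (\<lambda>i. ideal_gmodule R r (J i))))"

end

theory Submission
  imports Defs
begin

text \<open>
  Both sides of the equivalence describe a graded module with a homogeneous basis over \<open>R\<close> on
  which every monomial acts by an injective map of basis elements to basis elements. For \<open>R F\<close> the
  basis in degree \<open>v\<close> is the set \<open>F v\<close>; for a sum of monomial ideals \<open>J i\<close> it consists
  of one copy of \<open>x\<^sup>v\<close> for each \<open>i\<close> with \<open>x\<^sup>v \<in> J i\<close>. A monomial ideal is the span
  of the monomials with exponent in an upward closed set \<open>V\<close> (lemma \<open>monomial_ideal_iff\<close>), so it is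
  itself the span of the filtration that has one point in the degrees of \<open>V\<close> and none elsewhere.

  The theorem then says that a multifiltration is a disjoint union of such one-point filtrations.
  Call elements \<open>s \<in> F v\<close> and \<open>t \<in> F w\<close> linked if they have the same image in some common later
  degree. Functoriality makes this an equivalence relation, and injectivity of the transition maps
  says exactly that a class meets each \<open>F v\<close> in at most one point. The degrees met by a class are
  upward closed because transition maps stay inside a class. Hence \<open>F\<close> splits into its classes and
  \<open>R F\<close> into monomial ideals. Conversely the upward closed sets \<open>V i\<close> of a family of monomial ideals
  give the multifiltration \<open>v \<mapsto> {i. v \<in> V i}\<close>, whose maps are inclusions. The locale
  \<open>labelled_functor\<close> records a functor together with such a splitting, and
  \<open>ideal_sum_iso_span\<close> is the resulting isomorphism.

  The type arguments are handled by naming everything after elements of \<open>M\<close>. If \<open>1 \<noteq> 0\<close> in \<open>R\<close>, then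
  distinct classes, respectively distinct nonzero summands, are told apart by the elements of \<open>M\<close>
  that correspond to a chosen basis element of each. So whatever the type of the sets \<open>F v\<close>, the
  summands can be indexed by elements of \<open>M\<close> (\<open>span_imp_ideal_sum\<close>), and whatever the index type of
  the summands, the sets \<open>F v\<close> can be taken inside \<open>M\<close> (\<open>ideal_sum_imp_span\<close>). Composing the two
  implications gives all claims. If \<open>1 = 0\<close>, then \<open>M\<close> is zero, hence the empty sum and the span of
  the empty multifiltration.
\<close>


section \<open>Exponent vectors and polynomials\<close>

lemma expos_diff: "w \<in> expos r \<Longrightarrow> w - u \<in> expos r"
  by (simp add: expos_def)

lemma expos_sup: "u \<in> expos r \<Longrightarrow> v \<in> expos r \<Longrightarrow> sup u v \<in> expos r"
  by (simp add: expos_def)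

lemma diff_le_expo: "w - u \<le> (w :: nat \<Rightarrow> nat)"
  by (simp add: le_fun_def)

lemma expo_diff_diff_iff:
  fixes u v w :: "nat \<Rightarrow> nat"
  assumes "u \<le> v"
  shows "v - u \<le> w \<and> w - (v - u) = u \<longleftrightarrow> w = v"
proof
  assume L: "v - u \<le> w \<and> w - (v - u) = u"
  show "w = v"
  proof
    fix x
    have "v x - u x \<le> w x" "w x - (v x - u x) = u x" "u x \<le> v x"
      using L assms by (auto simp: le_fun_def dest: fun_cong[where x = x])
    then show "w x = v x" by arith
  qed
next
  assume "w = v"
  then show "v - u \<le> w \<and> w - (v - u) = u"
    using assms by (auto simp: le_fun_def fun_eq_iff)
qed

text \<open>
  The sum defining a product of polynomials needs a finite index set. The set
  \<open>{u. u \<le> w}\<close> is finite only because \<open>w\<close> has finite support.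
\<close>

lemma finite_expos_le:
  assumes "w \<in> expos r"
  shows "finite {u. u \<le> w}"
proof (rule finite_subset)
  show "{u. u \<le> w} \<subseteq> {f. \<forall>x. (x \<in> {..<r} \<longrightarrow> f x \<in> {..\<Sum>i<r. w i}) \<and> (x \<notin> {..<r} \<longrightarrow> f x = 0)}"
  proof
    fix u assume "u \<in> {u. u \<le> w}"
    then have u: "u x \<le> w x" for x by (simp add: le_fun_def)
    have "u x \<le> (\<Sum>i<r. w i)" if x: "x < r" for x
    proof -
      have "w x \<le> (\<Sum>i<r. w i)" by (rule member_le_sum) (use x in auto)
      then show ?thesis using u[of x] by linarith
    qed
    moreover have "u x = 0" if "\<not> x < r" for x
      using u[of x] that assms by (simp add: expos_def)
    ultimately show "u \<in> {f. \<forall>x. (x \<in> {..<r} \<longrightarrow> f x \<in> {..\<Sum>i<r. w i}) \<and> (x \<notin> {..<r} \<longrightarrow> f x = 0)}"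
      by simp
  qed
  show "finite {f. \<forall>x. (x \<in> {..<r} \<longrightarrow> f x \<in> {..\<Sum>i<r. w i}) \<and> (x \<notin> {..<r} \<longrightarrow> f x = (0::nat))}"
    by (rule finite_set_of_finite_funs) auto
qed

definition mterm :: "('a, 'z) ring_scheme \<Rightarrow> 'a \<Rightarrow> (nat \<Rightarrow> nat) \<Rightarrow> (nat \<Rightarrow> nat) \<Rightarrow> 'a" where
  "mterm R a v = (\<lambda>u. if u = v then a else \<zero>\<^bsub>R\<^esub>)"

lemma monomial_eq_mterm: "monomial R v = mterm R \<one>\<^bsub>R\<^esub> v"
  by (simp add: monomial_def mterm_def)

context cring
begin

lemma mterm_closed:
  "a \<in> carrier R \<Longrightarrow> v \<in> expos r \<Longrightarrow> mterm R a v \<in> carrier (mpoly_ring R r)"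
  by (auto simp: mpoly_ring_def mterm_def)

lemma mpoly_coeff: "p \<in> carrier (mpoly_ring R r) \<Longrightarrow> p v \<in> carrier R"
  by (simp add: mpoly_ring_def)

lemma mpoly_mult_coeff:
  "w \<in> expos r \<Longrightarrow> (p \<otimes>\<^bsub>mpoly_ring R r\<^esub> q) w = (\<Oplus>u\<in>{u. u \<le> w}. p u \<otimes> q (w - u))"
  by (simp add: mpoly_ring_def)

text \<open>
  Every term with exponent above \<open>u\<close> is a multiple of \<open>x\<^sup>u\<close>: this puts all terms with exponent in the
  upward closure of a set of exponents into the ideal generated by the corresponding monomials.
\<close>

lemma mterm_mult_monomial:
  assumes "a \<in> carrier R" "u \<in> expos r" "v \<in> expos r" "u \<le> v"
  shows "mterm R a (v - u) \<otimes>\<^bsub>mpoly_ring R r\<^esub> monomial R u = mterm R a v"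
proof
  fix w
  show "(mterm R a (v - u) \<otimes>\<^bsub>mpoly_ring R r\<^esub> monomial R u) w = mterm R a v w"
  proof (cases "w \<in> expos r")
    case False
    then show ?thesis using assms by (auto simp: mpoly_ring_def mterm_def)
  next
    case True
    let ?A = "{x. x \<le> w}"
    have fin: "finite ?A" using True by (rule finite_expos_le)
    (* Only the summand x = v - u can contribute, and it does so exactly when w = v. *)
    have uvw: "v - u \<le> w \<and> w - (v - u) = u \<longleftrightarrow> w = v"
      using \<open>u \<le> v\<close> by (rule expo_diff_diff_iff)
    have "(mterm R a (v - u) \<otimes>\<^bsub>mpoly_ring R r\<^esub> monomial R u) w =
        (\<Oplus>x\<in>?A. if v - u = x then (if w = v then a else \<zero>) else \<zero>)"
      unfolding mpoly_mult_coeff[OF True]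
    proof (rule add.finprod_cong')
      fix x assume x: "x \<in> ?A"
      show "mterm R a (v - u) x \<otimes> monomial R u (w - x) =
          (if v - u = x then (if w = v then a else \<zero>) else \<zero>)"
      proof (cases "x = v - u")
        case False
        then show ?thesis using assms(1) by (auto simp: mterm_def monomial_def)
      next
        case True
        then show ?thesis using assms(1) uvw x by (auto simp: mterm_def monomial_def)
      qed
    qed (use assms(1) in auto)
    also have "\<dots> = mterm R a v w"
    proof (cases "v - u \<in> ?A")
      case True
      then show ?thesis
        using add.finprod_singleton[OF True fin, of "\<lambda>_. if w = v then a else \<zero>"] assms(1)
        by (auto simp: mterm_def)
    next
      case False
      then have "w \<noteq> v" using uvw by auto
      have "(\<Oplus>x\<in>?A. if v - u = x then (if w = v then a else \<zero>) else \<zero>) = (\<Oplus>x\<in>?A. \<zero>)"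
        using \<open>w \<noteq> v\<close> by (intro add.finprod_cong') auto
      then show ?thesis using \<open>w \<noteq> v\<close> by (simp add: mterm_def)
    qed
    finally show ?thesis .
  qed
qed

end


section \<open>Monomial ideals and upsets\<close>

definition upset :: "nat \<Rightarrow> (nat \<Rightarrow> nat) set \<Rightarrow> bool" where
  "upset r V \<longleftrightarrow> V \<subseteq> expos r \<and> (\<forall>v\<in>V. \<forall>w\<in>expos r. v \<le> w \<longrightarrow> w \<in> V)"

text \<open>
  For an upset \<open>V\<close> this is the monomial ideal with \<open>R\<close>-basis \<open>{x\<^sup>v | v \<in> V}\<close>. Unlike a set of
  generators, \<open>V\<close> can be read off degree by degree.
\<close>

definition support_ideal ::
  "('a, 'z) ring_scheme \<Rightarrow> nat \<Rightarrow> (nat \<Rightarrow> nat) set \<Rightarrow> ((nat \<Rightarrow> nat) \<Rightarrow> 'a) set" where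
  "support_ideal R r V = {p \<in> carrier (mpoly_ring R r). \<forall>v. p v \<noteq> \<zero>\<^bsub>R\<^esub> \<longrightarrow> v \<in> V}"

text \<open>
  If the coefficient of \<open>p q\<close> at \<open>w\<close> is nonzero, then so is some coefficient of \<open>q\<close> at an exponent
  \<open>w - u \<le> w\<close>, and upward closure moves that exponent to \<open>w\<close>.
\<close>

lemma support_ideal_ideal:
  assumes R: "cring R" and P: "cring (mpoly_ring R r)" and V: "upset r V"
  shows "ideal (support_ideal R r V) (mpoly_ring R r)"
proof -
  interpret R: cring R by fact
  interpret P: cring "mpoly_ring R r" by fact
  let ?J = "support_ideal R r V"
  have mult: "p \<otimes>\<^bsub>mpoly_ring R r\<^esub> q \<in> ?J"
    if q: "q \<in> ?J" and p: "p \<in> carrier (mpoly_ring R r)" for p q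
  proof -
    have qc: "q \<in> carrier (mpoly_ring R r)" using q by (simp add: support_ideal_def)
    have "w \<in> V" if nz: "(p \<otimes>\<^bsub>mpoly_ring R r\<^esub> q) w \<noteq> \<zero>\<^bsub>R\<^esub>" for w
    proof -
      have w: "w \<in> expos r" using nz by (auto simp: mpoly_ring_def split: if_splits)
      have "\<exists>u. u \<le> w \<and> q (w - u) \<noteq> \<zero>\<^bsub>R\<^esub>"
      proof (rule ccontr)
        assume "\<not> ?thesis"
        then have "(\<Oplus>\<^bsub>R\<^esub>u\<in>{u. u \<le> w}. p u \<otimes>\<^bsub>R\<^esub> q (w - u)) = (\<Oplus>\<^bsub>R\<^esub>u\<in>{u. u \<le> w}. \<zero>\<^bsub>R\<^esub>)"
          by (intro R.add.finprod_cong') (auto simp: R.mpoly_coeff[OF p])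
        then show False using nz by (simp add: R.mpoly_mult_coeff[OF w])
      qed
      then obtain u where "q (w - u) \<noteq> \<zero>\<^bsub>R\<^esub>" by blast
      then have "w - u \<in> V" using q by (simp add: support_ideal_def)
      then show "w \<in> V" using V w diff_le_expo unfolding upset_def by blast
    qed
    then show ?thesis using P.m_closed[OF p qc] by (simp add: support_ideal_def)
  qed
  have inv: "\<ominus>\<^bsub>mpoly_ring R r\<^esub> p \<in> ?J" if "p \<in> ?J" for p
  proof -
    have "p \<in> carrier (mpoly_ring R r)" using that by (simp add: support_ideal_def)
    then have "\<ominus>\<^bsub>mpoly_ring R r\<^esub> p = (\<ominus>\<^bsub>mpoly_ring R r\<^esub> \<one>\<^bsub>mpoly_ring R r\<^esub>) \<otimes>\<^bsub>mpoly_ring R r\<^esub> p"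
      by (simp add: P.l_minus)
    then show ?thesis using mult[OF that] by simp
  qed
  have zero: "\<zero>\<^bsub>mpoly_ring R r\<^esub> \<in> ?J"
    using P.zero_closed by (simp add: support_ideal_def) (simp add: mpoly_ring_def)
  have add: "p \<oplus>\<^bsub>mpoly_ring R r\<^esub> q \<in> ?J" if "p \<in> ?J" "q \<in> ?J" for p q
  proof -
    have "(p \<oplus>\<^bsub>mpoly_ring R r\<^esub> q) v = p v \<oplus>\<^bsub>R\<^esub> q v" for v by (simp add: mpoly_ring_def)
    moreover have "p v \<oplus>\<^bsub>R\<^esub> q v \<noteq> \<zero>\<^bsub>R\<^esub> \<Longrightarrow> v \<in> V" for v
      using that R.mpoly_coeff[of q r v]
      by (cases "p v = \<zero>\<^bsub>R\<^esub>"; cases "q v = \<zero>\<^bsub>R\<^esub>") (auto simp: support_ideal_def)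
    moreover have "p \<oplus>\<^bsub>mpoly_ring R r\<^esub> q \<in> carrier (mpoly_ring R r)"
      using that by (simp add: support_ideal_def)
    ultimately show ?thesis by (simp add: support_ideal_def)
  qed
  have sub: "?J \<subseteq> carrier (mpoly_ring R r)" by (auto simp: support_ideal_def)
  show ?thesis
  proof (rule idealI)
    show "ring (mpoly_ring R r)" by (rule P.ring_axioms)
    show "subgroup ?J (add_monoid (mpoly_ring R r))"
      by (rule P.add.subgroupI) (use sub zero add inv in \<open>auto simp: a_inv_def\<close>)
    show "x \<otimes>\<^bsub>mpoly_ring R r\<^esub> a \<in> ?J" if "a \<in> ?J" "x \<in> carrier (mpoly_ring R r)" for a x
      using mult that by blast
    show "a \<otimes>\<^bsub>mpoly_ring R r\<^esub> x \<in> ?J" if "a \<in> ?J" "x \<in> carrier (mpoly_ring R r)" for a x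
    proof -
      have "a \<in> carrier (mpoly_ring R r)" using that sub by blast
      then show ?thesis using mult[OF that] that(2) by (metis P.m_comm)
    qed
  qed
qed

text \<open>
  Induction on the support: removing one term of \<open>p\<close> leaves a polynomial with smaller support, and
  the removed term is a multiple of a generator.
\<close>

lemma support_ideal_minimal:
  assumes R: "cring R" and P: "cring (mpoly_ring R r)" and J: "ideal J (mpoly_ring R r)"
    and U: "U \<subseteq> expos r" "monomial R ` U \<subseteq> J"
    and V: "V \<subseteq> {v \<in> expos r. \<exists>u\<in>U. u \<le> v}"
    and p: "p \<in> support_ideal R r V"
  shows "p \<in> J"
proof -
  interpret R: cring R by fact
  interpret P: cring "mpoly_ring R r" by fact
  interpret J: ideal J "mpoly_ring R r" by fact
  have "p \<in> J" if "finite A" "p \<in> carrier (mpoly_ring R r)" "{v. p v \<noteq> \<zero>\<^bsub>R\<^esub>} = A" "A \<subseteq> V" for A p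
    using that
  proof (induction A arbitrary: p rule: finite_induct)
    case empty
    then have "p = \<zero>\<^bsub>mpoly_ring R r\<^esub>" by (auto simp: mpoly_ring_def)
    then show ?case by simp
  next
    case (insert v A)
    (* p is its term at v plus the polynomial q with that term deleted. *)
    let ?q = "p(v := \<zero>\<^bsub>R\<^esub>)"
    have pv: "p v \<in> carrier R" using insert.prems(1) by (rule R.mpoly_coeff)
    have v: "v \<in> expos r" using insert.prems(3) V by auto
    obtain u where u: "u \<in> U" "u \<le> v" using insert.prems(3) V by auto
    have supp: "{w. ?q w \<noteq> \<zero>\<^bsub>R\<^esub>} = A" using insert.hyps(2) insert.prems(2) by auto
    have q: "?q \<in> carrier (mpoly_ring R r)"
      using insert.prems(1) insert.hyps(1) supp by (auto simp: mpoly_ring_def)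
    have "?q \<in> J" using insert.IH[OF q supp] insert.prems(3) by blast
    moreover have "mterm R (p v) v \<in> J"
    proof -
      have "mterm R (p v) (v - u) \<otimes>\<^bsub>mpoly_ring R r\<^esub> monomial R u \<in> J"
        using u U by (intro J.I_l_closed R.mterm_closed pv expos_diff v) auto
      then show ?thesis using R.mterm_mult_monomial[OF pv _ v u(2)] u U by auto
    qed
    moreover have "p = ?q \<oplus>\<^bsub>mpoly_ring R r\<^esub> mterm R (p v) v"
      using R.mpoly_coeff[OF insert.prems(1)] by (auto simp: mpoly_ring_def mterm_def)
    ultimately show ?case by (metis J.a_closed)
  qed
  moreover have "p \<in> carrier (mpoly_ring R r)" "finite {v. p v \<noteq> \<zero>\<^bsub>R\<^esub>}" "{v. p v \<noteq> \<zero>\<^bsub>R\<^esub>} \<subseteq> V"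
    using p by (auto simp: support_ideal_def mpoly_ring_def)
  ultimately show ?thesis by blast
qed

lemma genideal_monomials:
  assumes R: "cring R" and P: "cring (mpoly_ring R r)" and U: "U \<subseteq> expos r"
  shows "Idl\<^bsub>mpoly_ring R r\<^esub> (monomial R ` U) =
    support_ideal R r {v \<in> expos r. \<exists>u\<in>U. u \<le> v}" (is "_ = support_ideal R r ?V")
proof
  interpret R: cring R by fact
  interpret P: cring "mpoly_ring R r" by fact
  have closed: "monomial R ` U \<subseteq> carrier (mpoly_ring R r)"
    using U by (auto simp: monomial_eq_mterm intro: R.mterm_closed)
  have "upset r ?V" by (auto simp: upset_def intro: order_trans)
  then show "Idl\<^bsub>mpoly_ring R r\<^esub> (monomial R ` U) \<subseteq> support_ideal R r ?V"
    by (rule P.genideal_minimal[OF support_ideal_ideal[OF R P]])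
      (use U closed in \<open>auto simp: support_ideal_def monomial_def split: if_splits\<close>)
  show "support_ideal R r ?V \<subseteq> Idl\<^bsub>mpoly_ring R r\<^esub> (monomial R ` U)"
    using support_ideal_minimal[OF R P P.genideal_ideal[OF closed] U P.genideal_self[OF closed]]
    by blast
qed

lemma monomial_ideal_iff:
  assumes R: "cring R" and P: "cring (mpoly_ring R r)"
  shows "monomial_ideal R r J \<longleftrightarrow> (\<exists>V. upset r V \<and> J = support_ideal R r V)"
proof
  assume "monomial_ideal R r J"
  then obtain U where "U \<subseteq> expos r" "J = Idl\<^bsub>mpoly_ring R r\<^esub> (monomial R ` U)"
    by (auto simp: monomial_ideal_def)
  moreover have "upset r {v \<in> expos r. \<exists>u\<in>U. u \<le> v}"
    by (auto simp: upset_def intro: order_trans)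
  ultimately show "\<exists>V. upset r V \<and> J = support_ideal R r V"
    using genideal_monomials[OF R P] by blast
next
  assume "\<exists>V. upset r V \<and> J = support_ideal R r V"
  then obtain V where V: "upset r V" and J: "J = support_ideal R r V" by blast
  then have sub: "V \<subseteq> expos r" and "V = {v \<in> expos r. \<exists>u\<in>V. u \<le> v}"
    by (auto simp: upset_def)
  then have "J = Idl\<^bsub>mpoly_ring R r\<^esub> (monomial R ` V)"
    using genideal_monomials[OF R P sub] J by simp
  then show "monomial_ideal R r J" using sub by (auto simp: monomial_ideal_def)
qed


section \<open>Isomorphisms of graded modules\<close>

lemma graded_iso_sym: "graded_iso R r M N \<Longrightarrow> graded_iso R r N M"
  by (auto simp: graded_iso_def)

lemma graded_hom_comp:
  "\<phi> \<in> graded_hom R r M N \<Longrightarrow> \<psi> \<in> graded_hom R r N L \<Longrightarrow> \<psi> \<circ> \<phi> \<in> graded_hom R r M L"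
  unfolding graded_hom_def by (simp add: Pi_iff image_subset_iff)

lemma graded_iso_trans:
  assumes "graded_iso R r M N" "graded_iso R r N L"
  shows "graded_iso R r M L"
proof -
  obtain \<phi> \<psi> where 1: "\<phi> \<in> graded_hom R r M N" "\<psi> \<in> graded_hom R r N M"
    "\<And>x. x \<in> carrier M \<Longrightarrow> \<psi> (\<phi> x) = x" "\<And>y. y \<in> carrier N \<Longrightarrow> \<phi> (\<psi> y) = y"
    using assms(1) by (auto simp: graded_iso_def)
  obtain \<phi>' \<psi>' where 2: "\<phi>' \<in> graded_hom R r N L" "\<psi>' \<in> graded_hom R r L N"
    "\<And>x. x \<in> carrier N \<Longrightarrow> \<psi>' (\<phi>' x) = x" "\<And>y. y \<in> carrier L \<Longrightarrow> \<phi>' (\<psi>' y) = y"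
    using assms(2) by (auto simp: graded_iso_def)
  have "\<phi> x \<in> carrier N" if "x \<in> carrier M" for x using 1(1) that by (auto simp: graded_hom_def)
  moreover have "\<psi>' y \<in> carrier N" if "y \<in> carrier L" for y using 2(2) that by (auto simp: graded_hom_def)
  ultimately have "\<forall>x\<in>carrier M. (\<psi> \<circ> \<psi>') ((\<phi>' \<circ> \<phi>) x) = x" "\<forall>y\<in>carrier L. (\<phi>' \<circ> \<phi>) ((\<psi> \<circ> \<psi>') y) = y"
    using 1 2 by auto
  then show ?thesis unfolding graded_iso_def
    using graded_hom_comp[OF 1(1) 2(1)] graded_hom_comp[OF 2(2) 1(2)] by blast
qed

text \<open>
  The inverse of a bijective homomorphism is additive and linear by itself. That it
  respects the grading is a separate requirement, since only one inclusion between the pieces is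
  part of being a graded homomorphism.
\<close>

lemma graded_isoI:
  assumes hom: "\<phi> \<in> graded_hom R r M N"
    and \<psi>: "\<psi> \<in> carrier N \<rightarrow> carrier M"
    and inv: "\<And>x. x \<in> carrier M \<Longrightarrow> \<psi> (\<phi> x) = x" "\<And>y. y \<in> carrier N \<Longrightarrow> \<phi> (\<psi> y) = y"
    and add: "\<And>x y. x \<in> carrier M \<Longrightarrow> y \<in> carrier M \<Longrightarrow> x \<oplus>\<^bsub>M\<^esub> y \<in> carrier M"
    and smult: "\<And>p x. p \<in> carrier (mpoly_ring R r) \<Longrightarrow> x \<in> carrier M \<Longrightarrow> p \<odot>\<^bsub>M\<^esub> x \<in> carrier M"
    and piece: "\<And>v. v \<in> expos r \<Longrightarrow> \<psi> ` piece N v \<subseteq> piece M v"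
  shows "graded_iso R r M N"
proof -
  have \<psi>c: "\<psi> y \<in> carrier M" if "y \<in> carrier N" for y using \<psi> that by auto
  have "\<psi> (x \<oplus>\<^bsub>N\<^esub> y) = \<psi> x \<oplus>\<^bsub>M\<^esub> \<psi> y" if "x \<in> carrier N" "y \<in> carrier N" for x y
  proof -
    have "\<phi> (\<psi> x \<oplus>\<^bsub>M\<^esub> \<psi> y) = x \<oplus>\<^bsub>N\<^esub> y"
      using hom \<psi>c that inv by (simp add: graded_hom_def)
    then show ?thesis using inv(1)[OF add[OF \<psi>c[OF that(1)] \<psi>c[OF that(2)]]] by simp
  qed
  moreover have "\<psi> (p \<odot>\<^bsub>N\<^esub> x) = p \<odot>\<^bsub>M\<^esub> \<psi> x" if "p \<in> carrier (mpoly_ring R r)" "x \<in> carrier N" for p x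
  proof -
    have "\<phi> (p \<odot>\<^bsub>M\<^esub> \<psi> x) = p \<odot>\<^bsub>N\<^esub> x"
      using hom \<psi>c that inv by (simp add: graded_hom_def)
    then show ?thesis using inv(1)[OF smult[OF that(1) \<psi>c[OF that(2)]]] by simp
  qed
  ultimately have "\<psi> \<in> graded_hom R r N M"
    using \<psi> piece by (simp add: graded_hom_def)
  then show ?thesis using hom inv by (auto simp: graded_iso_def)
qed


section \<open>Coordinates on spans and on sums of monomial ideals\<close>

text \<open>
  The additive monoids occurring below are records with different extra fields, so they are
  compared through the three fields that matter.
\<close>

lemma group_cong:
  assumes "group G" "carrier H = carrier G" "monoid.mult H = monoid.mult G" "one H = one G"
  shows "group H"
  using assms unfolding group_def monoid_def group_axioms_def Units_def by simp

context cring
begin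

lemma group_regular_module: "group (add_monoid (regular_module R))"
  by (rule group_cong[OF add.is_group]) (simp_all add: regular_module_def)

lemma carrier_free_module:
  "carrier (free_module R S) = {f. f \<in> extensional S \<and> (\<forall>s\<in>S. f s \<in> carrier R) \<and> finite {s \<in> S. f s \<noteq> \<zero>}}"
  unfolding free_module_def direct_sum_def
  by (auto simp: carrier_sum_group[OF group_regular_module] PiE_iff)
     (auto simp: regular_module_def)

lemma zero_free_module: "\<zero>\<^bsub>free_module R S\<^esub> = (\<lambda>s\<in>S. \<zero>)"
  by (simp add: free_module_def direct_sum_def regular_module_def)

lemma add_free_module: "f \<oplus>\<^bsub>free_module R S\<^esub> g = (\<lambda>s\<in>S. f s \<oplus> g s)"
  by (simp add: free_module_def direct_sum_def regular_module_def)

lemma smult_free_module: "a \<odot>\<^bsub>free_module R S\<^esub> f = (\<lambda>s\<in>S. a \<otimes> f s)"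
  by (simp add: free_module_def direct_sum_def regular_module_def)

lemma free_module_smult_closed:
  assumes "a \<in> carrier R" "f \<in> carrier (free_module R S)"
  shows "a \<odot>\<^bsub>free_module R S\<^esub> f \<in> carrier (free_module R S)"
proof -
  have "{s \<in> S. a \<otimes> f s \<noteq> \<zero>} \<subseteq> {s \<in> S. f s \<noteq> \<zero>}" using assms(1) by auto
  then have "finite {s \<in> S. a \<otimes> f s \<noteq> \<zero>}"
    using assms(2) finite_subset by (auto simp: carrier_free_module)
  then show ?thesis using assms by (simp add: carrier_free_module smult_free_module cong: conj_cong)
qed

lemma abelian_group_free_module: "abelian_group (free_module R S)"
proof (rule abelian_groupI)
  fix f g assume fg: "f \<in> carrier (free_module R S)" "g \<in> carrier (free_module R S)"
  have "{s \<in> S. f s \<oplus> g s \<noteq> \<zero>} \<subseteq> {s \<in> S. f s \<noteq> \<zero>} \<union> {s \<in> S. g s \<noteq> \<zero>}" by auto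
  then have "finite {s \<in> S. f s \<oplus> g s \<noteq> \<zero>}"
    using fg finite_subset by (auto simp: carrier_free_module)
  then show "f \<oplus>\<^bsub>free_module R S\<^esub> g \<in> carrier (free_module R S)"
    using fg by (simp add: carrier_free_module add_free_module cong: conj_cong)
next
  fix f assume f: "f \<in> carrier (free_module R S)"
  show "\<exists>g\<in>carrier (free_module R S). g \<oplus>\<^bsub>free_module R S\<^esub> f = \<zero>\<^bsub>free_module R S\<^esub>"
  proof
    show "(\<ominus> \<one>) \<odot>\<^bsub>free_module R S\<^esub> f \<in> carrier (free_module R S)"
      using f by (intro free_module_smult_closed) auto
    show "(\<ominus> \<one>) \<odot>\<^bsub>free_module R S\<^esub> f \<oplus>\<^bsub>free_module R S\<^esub> f = \<zero>\<^bsub>free_module R S\<^esub>"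
      using f by (auto simp: carrier_free_module add_free_module smult_free_module zero_free_module
          l_minus l_neg)
  qed
qed (auto simp: carrier_free_module add_free_module zero_free_module a_ac extensional_def)

lemma finsum_free_module:
  assumes "finite A" "h \<in> A \<rightarrow> carrier (free_module R S)" "s \<in> S"
  shows "(\<Oplus>\<^bsub>free_module R S\<^esub>x\<in>A. h x) s = (\<Oplus>x\<in>A. h x s)"
proof -
  interpret G: abelian_group "free_module R S" by (rule abelian_group_free_module)
  show ?thesis using assms(1,2)
  proof (induction A rule: finite_induct)
    case empty
    then show ?case using assms(3) by (simp add: zero_free_module)
  next
    case (insert a A)
    have "(\<lambda>x. h x s) \<in> insert a A \<rightarrow> carrier R"
      using insert.prems assms(3) by (auto simp: carrier_free_module)
    then show ?case using insert assms(3)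
      by (simp add: G.finsum_insert finsum_insert add_free_module Pi_iff)
  qed
qed

lemma free_map_closed:
  assumes f: "f \<in> carrier (free_module R S)"
  shows "free_map R S S' t f \<in> carrier (free_module R S')"
proof -
  have val: "(\<Oplus>x\<in>{x \<in> S. t x = y \<and> f x \<noteq> \<zero>}. f x) \<in> carrier R" for y
    using f by (intro finsum_closed) (auto simp: carrier_free_module)
  have "y \<in> t ` {x \<in> S. f x \<noteq> \<zero>}" if "(\<Oplus>x\<in>{x \<in> S. t x = y \<and> f x \<noteq> \<zero>}. f x) \<noteq> \<zero>" for y
  proof (rule ccontr)
    assume "y \<notin> t ` {x \<in> S. f x \<noteq> \<zero>}"
    then have "{x \<in> S. t x = y \<and> f x \<noteq> \<zero>} = {}" by auto
    then show False using that by (simp only: finsum_empty simp_thms)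
  qed
  then have "{y \<in> S'. (\<Oplus>x\<in>{x \<in> S. t x = y \<and> f x \<noteq> \<zero>}. f x) \<noteq> \<zero>} \<subseteq> t ` {x \<in> S. f x \<noteq> \<zero>}"
    by auto
  moreover have "finite (t ` {x \<in> S. f x \<noteq> \<zero>})" using f by (simp add: carrier_free_module)
  ultimately have "finite {y \<in> S'. (\<Oplus>x\<in>{x \<in> S. t x = y \<and> f x \<noteq> \<zero>}. f x) \<noteq> \<zero>}"
    by (rule finite_subset)
  then show ?thesis using val by (simp add: carrier_free_module free_map_def cong: conj_cong)
qed

text \<open>
  The nested finiteness conditions, on the degrees and in each degree, amount to finiteness of the
  set of basis elements with nonzero coefficient. In this form the condition can be transported
  along a bijection of bases; the same holds for the next lemma.
\<close>

lemma carrier_span: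
  "carrier (span_gmodule R r F T) =
    {f \<in> extensional (expos r). (\<forall>v\<in>expos r. f v \<in> extensional (F v) \<and> (\<forall>s\<in>F v. f v s \<in> carrier R)) \<and>
       finite {(v, s). v \<in> expos r \<and> s \<in> F v \<and> f v s \<noteq> \<zero>}}" (is "_ = ?C")
proof -
  have grp: "group (add_monoid (free_module R (F v)))" for v
    using abelian_group.a_group[OF abelian_group_free_module] .
  have "carrier (span_gmodule R r F T) =
    {f \<in> extensional (expos r). (\<forall>v\<in>expos r. f v \<in> carrier (free_module R (F v))) \<and>
       finite {v \<in> expos r. f v \<noteq> (\<lambda>s\<in>F v. \<zero>)}}" (is "_ = ?D")
  proof -
    have "carrier (span_gmodule R r F T) = carrier (sum_group (expos r) (\<lambda>v. add_monoid (free_module R (F v))))"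
      by (simp add: span_gmodule_def functor_gmodule_def direct_sum_def)
    also have "\<dots> = ?D"
      by (subst carrier_sum_group[OF grp]) (auto simp: PiE_iff zero_free_module)
    finally show ?thesis .
  qed
  also have "\<dots> = ?C"
  proof (intro equalityI subsetI)
    fix f assume f: "f \<in> ?D"
    let ?A = "{v \<in> expos r. f v \<noteq> (\<lambda>s\<in>F v. \<zero>)}"
    have "{(v, s). v \<in> expos r \<and> s \<in> F v \<and> f v s \<noteq> \<zero>} \<subseteq> (SIGMA v:?A. {s \<in> F v. f v s \<noteq> \<zero>})"
      by auto
    moreover have "finite (SIGMA v:?A. {s \<in> F v. f v s \<noteq> \<zero>})"
      using f by (intro finite_SigmaI) (auto simp: carrier_free_module)
    ultimately have "finite {(v, s). v \<in> expos r \<and> s \<in> F v \<and> f v s \<noteq> \<zero>}" by (rule finite_subset)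
    then show "f \<in> ?C" using f by (auto simp: carrier_free_module)
  next
    fix f assume f: "f \<in> ?C"
    let ?B = "{(v, s). v \<in> expos r \<and> s \<in> F v \<and> f v s \<noteq> \<zero>}"
    have fin: "finite ?B" using f by simp
    have "finite {s \<in> F v. f v s \<noteq> \<zero>}" if "v \<in> expos r" for v
    proof (rule finite_subset)
      show "{s \<in> F v. f v s \<noteq> \<zero>} \<subseteq> snd ` ?B" using that by force
    qed (use fin in simp)
    moreover have "finite {v \<in> expos r. f v \<noteq> (\<lambda>s\<in>F v. \<zero>)}"
    proof (rule finite_subset)
      show "{v \<in> expos r. f v \<noteq> (\<lambda>s\<in>F v. \<zero>)} \<subseteq> fst ` ?B"
      proof
        fix v assume v: "v \<in> {v \<in> expos r. f v \<noteq> (\<lambda>s\<in>F v. \<zero>)}"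
        then have ext: "f v \<in> extensional (F v)" using f by auto
        have "\<exists>s\<in>F v. f v s \<noteq> \<zero>"
        proof (rule ccontr)
          assume "\<not> ?thesis"
          then have "f v = (\<lambda>s\<in>F v. \<zero>)" using ext by (auto simp: extensional_def fun_eq_iff)
          then show False using v by auto
        qed
        then show "v \<in> fst ` ?B" using v by force
      qed
    qed (use fin in simp)
    ultimately show "f \<in> ?D" using f by (simp add: carrier_free_module)
  qed
  finally show ?thesis .
qed

lemma carrier_ideal_sum:
  fixes I :: "'i set"
  assumes P: "cring (mpoly_ring R r)" and V: "\<And>i. i \<in> I \<Longrightarrow> upset r (V i)"
  shows "carrier (graded_direct_sum I (\<lambda>i. ideal_gmodule R r (support_ideal R r (V i)))) =
    {g \<in> extensional I. (\<forall>i\<in>I. g i \<in> support_ideal R r (V i)) \<and>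
       finite {(i, v). i \<in> I \<and> g i v \<noteq> \<zero>}}" (is "_ = ?C")
proof -
  let ?N = "\<lambda>i. ideal_gmodule R r (support_ideal R r (V i))"
  have grp: "group (add_monoid (?N i))" if "i \<in> I" for i
  proof -
    interpret J: ideal "support_ideal R r (V i)" "mpoly_ring R r"
      using support_ideal_ideal[OF cring_axioms P V[OF that]] .
    show ?thesis
      by (rule group_cong[OF subgroup.subgroup_is_group[OF J.a_subgroup J.add.is_group]])
        (simp_all add: ideal_gmodule_def)
  qed
  have "carrier (graded_direct_sum I ?N) =
    {g \<in> extensional I. (\<forall>i\<in>I. g i \<in> support_ideal R r (V i)) \<and>
       finite {i \<in> I. g i \<noteq> (\<lambda>v. \<zero>)}}" (is "_ = ?D")
  proof -
    have "carrier (graded_direct_sum I ?N) = carrier (sum_group I (\<lambda>i. add_monoid (?N i)))"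
      by (simp add: graded_direct_sum_def module.defs direct_sum_def)
    also have "\<dots> = ?D"
      by (subst carrier_sum_group[OF grp])
        (auto simp: PiE_iff ideal_gmodule_def mpoly_ring_def)
    finally show ?thesis .
  qed
  also have "\<dots> = ?C"
  proof (intro equalityI subsetI)
    fix g assume g: "g \<in> ?D"
    let ?A = "{i \<in> I. g i \<noteq> (\<lambda>v. \<zero>)}"
    have "{(i, v). i \<in> I \<and> g i v \<noteq> \<zero>} \<subseteq> (SIGMA i:?A. {v. g i v \<noteq> \<zero>})"
      by auto
    moreover have "finite (SIGMA i:?A. {v. g i v \<noteq> \<zero>})"
      using g by (intro finite_SigmaI) (auto simp: support_ideal_def mpoly_ring_def)
    ultimately have "finite {(i, v). i \<in> I \<and> g i v \<noteq> \<zero>}" by (rule finite_subset)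
    then show "g \<in> ?C" using g by simp
  next
    fix g assume g: "g \<in> ?C"
    have "finite {i \<in> I. g i \<noteq> (\<lambda>v. \<zero>)}"
    proof (rule finite_subset)
      show "{i \<in> I. g i \<noteq> (\<lambda>v. \<zero>)} \<subseteq> fst ` {(i, v). i \<in> I \<and> g i v \<noteq> \<zero>}"
        by (force simp: fun_eq_iff)
    qed (use g in simp)
    then show "g \<in> ?D" using g by simp
  qed
  finally show ?thesis .
qed

lemma add_span:
  "f \<oplus>\<^bsub>span_gmodule R r F T\<^esub> g = (\<lambda>v\<in>expos r. \<lambda>s\<in>F v. f v s \<oplus> g v s)"
  by (simp add: span_gmodule_def functor_gmodule_def direct_sum_def add_free_module)

lemma add_ideal_sum:
  "f \<oplus>\<^bsub>graded_direct_sum I (\<lambda>i. ideal_gmodule R r (J i))\<^esub> g = (\<lambda>i\<in>I. f i \<oplus>\<^bsub>mpoly_ring R r\<^esub> g i)"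
  by (simp add: graded_direct_sum_def module.defs direct_sum_def ideal_gmodule_def)

lemma smult_ideal_sum:
  "p \<odot>\<^bsub>graded_direct_sum I (\<lambda>i. ideal_gmodule R r (J i))\<^esub> g = (\<lambda>i\<in>I. p \<otimes>\<^bsub>mpoly_ring R r\<^esub> g i)"
  by (simp add: graded_direct_sum_def module.defs direct_sum_def ideal_gmodule_def)

lemma piece_span:
  "piece (span_gmodule R r F T) v = {f \<in> carrier (span_gmodule R r F T).
     \<forall>w\<in>expos r. w \<noteq> v \<longrightarrow> (\<forall>s\<in>F w. f w s = \<zero>)}"
proof -
  have "f w = (\<lambda>s\<in>F w. \<zero>) \<longleftrightarrow> (\<forall>s\<in>F w. f w s = \<zero>)"
    if "f \<in> carrier (span_gmodule R r F T)" "w \<in> expos r" for f w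
    using that by (auto simp: carrier_span extensional_def fun_eq_iff)
  then have "piece (span_gmodule R r F T) v = {f \<in> carrier (span_gmodule R r F T).
     \<forall>w\<in>expos r. w \<noteq> v \<longrightarrow> f w = (\<lambda>s\<in>F w. \<zero>)}
     \<Longrightarrow> ?thesis" by auto
  moreover have "piece (span_gmodule R r F T) v = {f \<in> carrier (span_gmodule R r F T).
     \<forall>w\<in>expos r. w \<noteq> v \<longrightarrow> f w = (\<lambda>s\<in>F w. \<zero>)}"
    by (simp add: span_gmodule_def functor_gmodule_def zero_free_module)
  ultimately show ?thesis by blast
qed

lemma piece_ideal_sum:
  assumes P: "cring (mpoly_ring R r)" and V: "\<And>i. i \<in> I \<Longrightarrow> upset r (V i)"
  defines "N \<equiv> graded_direct_sum I (\<lambda>i. ideal_gmodule R r (support_ideal R r (V i)))"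
  shows "piece N v = {g \<in> carrier N. \<forall>i\<in>I. \<forall>w. w \<noteq> v \<longrightarrow> g i w = \<zero>}"
proof -
  have "piece N v = {g \<in> carrier N.
      \<forall>i\<in>I. g i \<in> support_ideal R r (V i) \<inter> homogeneous_part R r v}"
    by (simp add: N_def graded_direct_sum_def module.defs direct_sum_def ideal_gmodule_def)
  moreover have "g i \<in> support_ideal R r (V i) \<inter> homogeneous_part R r v \<longleftrightarrow> (\<forall>w. w \<noteq> v \<longrightarrow> g i w = \<zero>)"
    if "g \<in> carrier N" "i \<in> I" for g i
  proof -
    have "g i \<in> support_ideal R r (V i)"
      using carrier_ideal_sum[of r I V, OF P V] that by (simp add: N_def)
    then show ?thesis by (auto simp: homogeneous_part_def support_ideal_def)
  qed
  ultimately show ?thesis by (simp del: Int_iff cong: conj_cong ball_cong)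
qed

text \<open>
  The action is a finite sum in the free module on \<open>F w\<close>, which can be evaluated coordinatewise. The
  inner sum is the coefficient at \<open>t\<close> of the push-forward of \<open>f (w - u)\<close>.
\<close>

lemma smult_span:
  assumes p: "p \<in> carrier (mpoly_ring R r)" and f: "f \<in> carrier (span_gmodule R r F T)"
  shows "p \<odot>\<^bsub>span_gmodule R r F T\<^esub> f = (\<lambda>w\<in>expos r. \<lambda>t\<in>F w.
    \<Oplus>u\<in>{u. u \<le> w}. p u \<otimes> (\<Oplus>x\<in>{x \<in> F (w - u). T (w - u) w x = t \<and> f (w - u) x \<noteq> \<zero>}. f (w - u) x))"
proof -
  have "(\<Oplus>\<^bsub>free_module R (F w)\<^esub>u\<in>{u. u \<le> w}. p u \<odot>\<^bsub>free_module R (F w)\<^esub>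
          free_map R (F (w - u)) (F w) (T (w - u) w) (f (w - u))) =
    (\<lambda>t\<in>F w. \<Oplus>u\<in>{u. u \<le> w}. p u \<otimes>
       (\<Oplus>x\<in>{x \<in> F (w - u). T (w - u) w x = t \<and> f (w - u) x \<noteq> \<zero>}. f (w - u) x))"
    (is "finsum ?G ?h ?A = _") if w: "w \<in> expos r" for w
  proof -
    interpret G: abelian_group ?G by (rule abelian_group_free_module)
    have "f v \<in> carrier (free_module R (F v))" if v: "v \<in> expos r" for v
    proof -
      have "{s \<in> F v. f v s \<noteq> \<zero>} \<subseteq> snd ` {(v, s). v \<in> expos r \<and> s \<in> F v \<and> f v s \<noteq> \<zero>}"
        using v by force
      moreover have "finite {(v, s). v \<in> expos r \<and> s \<in> F v \<and> f v s \<noteq> \<zero>}"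
        using f by (simp add: carrier_span)
      ultimately have "finite {s \<in> F v. f v s \<noteq> \<zero>}" by (meson finite_imageI finite_subset)
      then show ?thesis using f v by (simp add: carrier_span carrier_free_module)
    qed
    then have h: "?h \<in> ?A \<rightarrow> carrier ?G"
      using w by (auto intro!: free_module_smult_closed free_map_closed mpoly_coeff[OF p] expos_diff)
    then have "finsum ?G ?h ?A \<in> extensional (F w)"
      using G.finsum_closed[OF h] by (simp add: carrier_free_module)
    moreover have "finsum ?G ?h ?A t = (\<Oplus>u\<in>{u. u \<le> w}. p u \<otimes>
       (\<Oplus>x\<in>{x \<in> F (w - u). T (w - u) w x = t \<and> f (w - u) x \<noteq> \<zero>}. f (w - u) x))" if "t \<in> F w" for t
      using finsum_free_module[OF finite_expos_le[OF w] h that] that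
      by (simp add: smult_free_module free_map_def)
    ultimately show ?thesis by (auto simp: fun_eq_iff extensional_def)
  qed
  then show ?thesis
    by (simp add: span_gmodule_def functor_gmodule_def cong: restrict_cong)
qed

end


section \<open>Splitting a multifiltration into labelled components\<close>

text \<open>
  A functor split into one-point components: \<open>c v s\<close> is the component of \<open>s \<in> F v\<close>, and \<open>V i\<close> is the
  set of degrees in which the component \<open>i\<close> has its single element. That there is only one element
  makes the transition maps injective, since these preserve components. Components with empty \<open>V i\<close>
  are permitted; they correspond to zero ideals among the summands.
\<close>

locale labelled_functor = cring R for R :: "('a, 'z) ring_scheme" (structure) +
  fixes r :: nat
    and F :: "(nat \<Rightarrow> nat) \<Rightarrow> 's set" and T :: "(nat \<Rightarrow> nat) \<Rightarrow> (nat \<Rightarrow> nat) \<Rightarrow> 's \<Rightarrow> 's"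
    and I :: "'i set" and V :: "'i \<Rightarrow> (nat \<Rightarrow> nat) set" and c :: "(nat \<Rightarrow> nat) \<Rightarrow> 's \<Rightarrow> 'i"
  assumes poly: "cring (mpoly_ring R r)"
    and T_maps: "\<lbrakk>v \<in> expos r; w \<in> expos r; v \<le> w\<rbrakk> \<Longrightarrow> T v w \<in> F v \<rightarrow> F w"
    and V_upset: "i \<in> I \<Longrightarrow> upset r (V i)"
    and label_bij: "v \<in> expos r \<Longrightarrow> bij_betw (c v) (F v) {i \<in> I. v \<in> V i}"
    and label_T: "\<lbrakk>v \<in> expos r; w \<in> expos r; v \<le> w; s \<in> F v\<rbrakk> \<Longrightarrow> c w (T v w s) = c v s"
begin

abbreviation "span_mod \<equiv> span_gmodule R r F T"

abbreviation "ideal_sum \<equiv> graded_direct_sum I (\<lambda>i. ideal_gmodule R r (support_ideal R r (V i)))"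

text \<open>
  The element in degree \<open>v\<close> of the component \<open>i\<close>; meaningful for \<open>v \<in> V i\<close>.
\<close>

definition elt :: "(nat \<Rightarrow> nat) \<Rightarrow> 'i \<Rightarrow> 's" where
  "elt v = inv_into (F v) (c v)"

lemma label_mem: "v \<in> expos r \<Longrightarrow> s \<in> F v \<Longrightarrow> c v s \<in> I \<and> v \<in> V (c v s)"
  using label_bij by (auto dest: bij_betwE)

lemma V_expos: "i \<in> I \<Longrightarrow> v \<in> V i \<Longrightarrow> v \<in> expos r"
  using V_upset by (auto simp: upset_def)

lemma elt_mem: "i \<in> I \<Longrightarrow> v \<in> V i \<Longrightarrow> elt v i \<in> F v"
  unfolding elt_def using label_bij[of v] V_expos[of i v]
  by (auto simp: bij_betw_def intro: inv_into_into)

lemma label_elt: "i \<in> I \<Longrightarrow> v \<in> V i \<Longrightarrow> c v (elt v i) = i"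
  unfolding elt_def using label_bij[of v] V_expos[of i v]
  by (auto simp: bij_betw_def intro: f_inv_into_f)

lemma elt_label: "v \<in> expos r \<Longrightarrow> s \<in> F v \<Longrightarrow> elt v (c v s) = s"
  unfolding elt_def using label_bij[of v] by (auto simp: bij_betw_def)

lemmas carrier_ideals = carrier_ideal_sum[of r I V, OF poly V_upset, simplified]

lemmas piece_ideals = piece_ideal_sum[of r I V, OF poly V_upset, simplified]

text \<open>
  Both modules have as a basis the pairs of a component and a degree in which it is inhabited. The
  two maps below match coefficients along \<open>s \<mapsto> c v s\<close> and its inverse \<open>elt v\<close>.
\<close>

definition to_span :: "('i \<Rightarrow> (nat \<Rightarrow> nat) \<Rightarrow> 'a) \<Rightarrow> (nat \<Rightarrow> nat) \<Rightarrow> 's \<Rightarrow> 'a" where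
  "to_span g = (\<lambda>v\<in>expos r. \<lambda>s\<in>F v. g (c v s) v)"

definition to_ideals :: "((nat \<Rightarrow> nat) \<Rightarrow> 's \<Rightarrow> 'a) \<Rightarrow> 'i \<Rightarrow> (nat \<Rightarrow> nat) \<Rightarrow> 'a" where
  "to_ideals f = (\<lambda>i\<in>I. \<lambda>v. if v \<in> V i then f v (elt v i) else \<zero>)"

lemma ideals_coeff:
  assumes "g \<in> carrier ideal_sum" "i \<in> I"
  shows "g i \<in> carrier (mpoly_ring R r)" "g i v \<in> carrier R" "g i v \<noteq> \<zero> \<Longrightarrow> v \<in> V i"
proof -
  have "g i \<in> support_ideal R r (V i)" using assms by (simp add: carrier_ideals)
  then show "g i \<in> carrier (mpoly_ring R r)" "g i v \<in> carrier R" "g i v \<noteq> \<zero> \<Longrightarrow> v \<in> V i"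
    by (auto simp: support_ideal_def mpoly_coeff)
qed

lemma to_span_closed:
  assumes g: "g \<in> carrier ideal_sum"
  shows "to_span g \<in> carrier span_mod"
proof -
  have "{(v, s). v \<in> expos r \<and> s \<in> F v \<and> to_span g v s \<noteq> \<zero>} \<subseteq>
      (\<lambda>(i, v). (v, elt v i)) ` {(i, v). i \<in> I \<and> g i v \<noteq> \<zero>}"
  proof clarify
    fix v s assume vs: "v \<in> expos r" "s \<in> F v" and nz: "to_span g v s \<noteq> \<zero>"
    have "(c v s, v) \<in> {(i, v). i \<in> I \<and> g i v \<noteq> \<zero>}"
      using vs nz label_mem by (auto simp: to_span_def)
    moreover have "(v, s) = (\<lambda>(i, v). (v, elt v i)) (c v s, v)"
      using elt_label[OF vs] by simp
    ultimately show "(v, s) \<in> (\<lambda>(i, v). (v, elt v i)) ` {(i, v). i \<in> I \<and> g i v \<noteq> \<zero>}"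
      by (rule rev_image_eqI)
  qed
  moreover have "finite {(i, v). i \<in> I \<and> g i v \<noteq> \<zero>}" using g by (simp add: carrier_ideals)
  ultimately have "finite {(v, s). v \<in> expos r \<and> s \<in> F v \<and> to_span g v s \<noteq> \<zero>}"
    by (meson finite_imageI finite_subset)
  then show ?thesis using ideals_coeff[OF g] label_mem by (simp add: carrier_span) (simp add: to_span_def)
qed

lemma to_ideals_closed:
  assumes f: "f \<in> carrier span_mod"
  shows "to_ideals f \<in> carrier ideal_sum"
proof -
  let ?B = "{(v, s). v \<in> expos r \<and> s \<in> F v \<and> f v s \<noteq> \<zero>}"
  let ?C = "{(i, v). i \<in> I \<and> to_ideals f i v \<noteq> \<zero>}"
  have "?C \<subseteq> (\<lambda>(v, s). (c v s, v)) ` ?B"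
  proof clarify
    fix i v assume i: "i \<in> I" and nz: "to_ideals f i v \<noteq> \<zero>"
    then have v: "v \<in> V i" "f v (elt v i) \<noteq> \<zero>" by (auto simp: to_ideals_def split: if_splits)
    then have "(v, elt v i) \<in> ?B" using i elt_mem V_expos by auto
    moreover have "(i, v) = (\<lambda>(v, s). (c v s, v)) (v, elt v i)"
      using label_elt[OF i v(1)] by simp
    ultimately show "(i, v) \<in> (\<lambda>(v, s). (c v s, v)) ` ?B" by (rule rev_image_eqI)
  qed
  moreover have "finite ?B" using f by (simp add: carrier_span)
  ultimately have fin: "finite ?C" by (meson finite_imageI finite_subset)
  have "to_ideals f i \<in> support_ideal R r (V i)" if i: "i \<in> I" for i
  proof -
    have "{v. to_ideals f i v \<noteq> \<zero>} \<subseteq> snd ` ?C" using i by force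
    then have "finite {v. to_ideals f i v \<noteq> \<zero>}" using fin by (meson finite_imageI finite_subset)
    moreover have "to_ideals f i v \<in> carrier R" for v
      using f i elt_mem[OF i] V_expos[OF i] by (auto simp: to_ideals_def carrier_span)
    moreover have "to_ideals f i v = \<zero>" if "v \<notin> V i" for v using that i by (simp add: to_ideals_def)
    ultimately show ?thesis using V_expos[OF i] by (auto simp: support_ideal_def mpoly_ring_def)
  qed
  moreover have "to_ideals f \<in> extensional I" by (simp add: to_ideals_def)
  ultimately show ?thesis using fin by (simp add: carrier_ideals)
qed

lemma to_ideals_to_span:
  assumes g: "g \<in> carrier ideal_sum"
  shows "to_ideals (to_span g) = g"
proof -
  have "to_ideals (to_span g) i = g i" if i: "i \<in> I" for i
  proof
    fix v
    show "to_ideals (to_span g) i v = g i v"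
    proof (cases "v \<in> V i")
      case True
      then show ?thesis
        using i V_expos[OF i] elt_mem[OF i] label_elt[OF i] by (simp add: to_ideals_def to_span_def)
    next
      case False
      then have "g i v = \<zero>" using ideals_coeff(3)[OF g i] by blast
      then show ?thesis using i False by (simp add: to_ideals_def)
    qed
  qed
  moreover have "g \<in> extensional I" using g by (simp add: carrier_ideals)
  moreover have "to_ideals (to_span g) \<in> extensional I" by (simp add: to_ideals_def)
  ultimately show ?thesis by (intro extensionalityI[where A = I]) auto
qed

lemma to_span_to_ideals:
  assumes f: "f \<in> carrier span_mod"
  shows "to_span (to_ideals f) = f"
proof -
  have "to_span (to_ideals f) v = f v" if v: "v \<in> expos r" for v
  proof -
    have "to_span (to_ideals f) v s = f v s" if s: "s \<in> F v" for s
      using v s label_mem[OF v s] elt_label[OF v s] by (simp add: to_ideals_def to_span_def)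
    moreover have "f v \<in> extensional (F v)" using f v by (simp add: carrier_span)
    moreover have "to_span (to_ideals f) v \<in> extensional (F v)" using v by (simp add: to_span_def)
    ultimately show ?thesis by (intro extensionalityI[where A = "F v"]) auto
  qed
  moreover have "f \<in> extensional (expos r)" using f by (simp add: carrier_span)
  moreover have "to_span (to_ideals f) \<in> extensional (expos r)" by (simp add: to_span_def)
  ultimately show ?thesis by (intro extensionalityI[where A = "expos r"]) auto
qed

lemma ideal_sum_add_closed:
  assumes "f \<in> carrier ideal_sum" "g \<in> carrier ideal_sum"
  shows "f \<oplus>\<^bsub>ideal_sum\<^esub> g \<in> carrier ideal_sum"
proof -
  have "f i \<oplus>\<^bsub>mpoly_ring R r\<^esub> g i \<in> support_ideal R r (V i)" if i: "i \<in> I" for i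
  proof -
    interpret J: ideal "support_ideal R r (V i)" "mpoly_ring R r"
      using support_ideal_ideal[OF cring_axioms poly V_upset[OF i]] .
    show ?thesis using assms i J.a_closed[of "f i" "g i"] by (simp add: carrier_ideals)
  qed
  moreover have "{(i, v). i \<in> I \<and> (f i \<oplus>\<^bsub>mpoly_ring R r\<^esub> g i) v \<noteq> \<zero>} \<subseteq>
      {(i, v). i \<in> I \<and> f i v \<noteq> \<zero>} \<union> {(i, v). i \<in> I \<and> g i v \<noteq> \<zero>}"
    by (auto simp: mpoly_ring_def)
  moreover have "finite ({(i, v). i \<in> I \<and> f i v \<noteq> \<zero>} \<union> {(i, v). i \<in> I \<and> g i v \<noteq> \<zero>})"
    using assms by (simp add: carrier_ideals)
  ultimately show ?thesis
    by (auto simp: carrier_ideals add_ideal_sum intro: finite_subset cong: conj_cong)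
qed

lemma ideal_sum_smult_closed:
  assumes p: "p \<in> carrier (mpoly_ring R r)" and g: "g \<in> carrier ideal_sum"
  shows "p \<odot>\<^bsub>ideal_sum\<^esub> g \<in> carrier ideal_sum"
proof -
  interpret P: cring "mpoly_ring R r" by (rule poly)
  have mem: "p \<otimes>\<^bsub>mpoly_ring R r\<^esub> g i \<in> support_ideal R r (V i)" if i: "i \<in> I" for i
  proof -
    interpret J: ideal "support_ideal R r (V i)" "mpoly_ring R r"
      using support_ideal_ideal[OF cring_axioms poly V_upset[OF i]] .
    show ?thesis using p g i J.I_l_closed[of "g i" p] by (simp add: carrier_ideals)
  qed
  have zero: "\<zero>\<^bsub>mpoly_ring R r\<^esub> v = \<zero>" for v by (simp add: mpoly_ring_def)
  let ?A = "fst ` {(i, v). i \<in> I \<and> g i v \<noteq> \<zero>}"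
  have fin: "finite ?A" using g by (simp add: carrier_ideals)
  have gz: "g i = \<zero>\<^bsub>mpoly_ring R r\<^esub>" if "i \<in> I" "i \<notin> ?A" for i
    using that by (force simp: mpoly_ring_def fun_eq_iff)
  have "{(i, v). i \<in> I \<and> (p \<otimes>\<^bsub>mpoly_ring R r\<^esub> g i) v \<noteq> \<zero>} \<subseteq>
      (SIGMA i:?A. {v. (p \<otimes>\<^bsub>mpoly_ring R r\<^esub> g i) v \<noteq> \<zero>})"
  proof
    fix x assume "x \<in> {(i, v). i \<in> I \<and> (p \<otimes>\<^bsub>mpoly_ring R r\<^esub> g i) v \<noteq> \<zero>}"
    then obtain i v where x: "x = (i, v)" and i: "i \<in> I" and nz: "(p \<otimes>\<^bsub>mpoly_ring R r\<^esub> g i) v \<noteq> \<zero>"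
      by blast
    have "i \<in> ?A"
    proof (rule ccontr)
      assume "i \<notin> ?A"
      then show False using nz gz[OF i] p zero by simp
    qed
    then show "x \<in> (SIGMA i:?A. {v. (p \<otimes>\<^bsub>mpoly_ring R r\<^esub> g i) v \<noteq> \<zero>})"
      unfolding x using nz by (intro SigmaI) simp_all
  qed
  moreover have "finite (SIGMA i:?A. {v. (p \<otimes>\<^bsub>mpoly_ring R r\<^esub> g i) v \<noteq> \<zero>})"
  proof (intro finite_SigmaI fin)
    fix i assume "i \<in> ?A"
    then have "p \<otimes>\<^bsub>mpoly_ring R r\<^esub> g i \<in> carrier (mpoly_ring R r)"
      using mem by (auto simp: support_ideal_def)
    then show "finite {v. (p \<otimes>\<^bsub>mpoly_ring R r\<^esub> g i) v \<noteq> \<zero>}"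
      unfolding mpoly_ring_def by simp
  qed
  ultimately have "finite {(i, v). i \<in> I \<and> (p \<otimes>\<^bsub>mpoly_ring R r\<^esub> g i) v \<noteq> \<zero>}"
    by (rule finite_subset)
  then show ?thesis using mem by (simp add: carrier_ideals smult_ideal_sum cong: conj_cong)
qed

text \<open>
  A coefficient in degree \<open>v\<close> pushed forward to \<open>t \<in> F w\<close> can only come from the component of \<open>t\<close>. If
  this component is inhabited in degree \<open>v\<close>, its element there is the unique preimage of \<open>t\<close>;
  otherwise there is no preimage, and the corresponding coefficient of the ideal is zero as well.
\<close>

lemma transition_coeff:
  assumes g: "g \<in> carrier ideal_sum" and v: "v \<in> expos r" and w: "w \<in> expos r" and vw: "v \<le> w"
    and t: "t \<in> F w"
  shows "(\<Oplus>x\<in>{x \<in> F v. T v w x = t \<and> to_span g v x \<noteq> \<zero>}. to_span g v x) = g (c w t) v"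
proof -
  let ?i = "c w t"
  have i: "?i \<in> I" using label_mem[OF w t] by simp
  have val: "to_span g v x = g (c v x) v" if "x \<in> F v" for x
    using that v by (simp add: to_span_def)
  have eq: "T v w x = t \<longleftrightarrow> c v x = ?i" if x: "x \<in> F v" for x
  proof -
    have "T v w x \<in> F w" using T_maps[OF v w vw] x by auto
    moreover have "inj_on (c w) (F w)" using label_bij[OF w] by (simp add: bij_betw_def)
    ultimately have "T v w x = t \<longleftrightarrow> c w (T v w x) = ?i" using t by (simp add: inj_on_eq_iff)
    then show ?thesis using label_T[OF v w vw x] by simp
  qed
  then have set: "{x \<in> F v. T v w x = t \<and> to_span g v x \<noteq> \<zero>} = {x \<in> F v. c v x = ?i \<and> g ?i v \<noteq> \<zero>}"
    using val eq by (intro Collect_cong) metis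
  show ?thesis
  proof (cases "g ?i v = \<zero>")
    case True
    then show ?thesis unfolding set by simp
  next
    case False
    then have V: "v \<in> V ?i" by (rule ideals_coeff(3)[OF g i])
    have "{x \<in> F v. c v x = ?i \<and> g ?i v \<noteq> \<zero>} = {elt v ?i}"
      using False elt_mem[OF i V] label_elt[OF i V] elt_label[OF v] by (auto, metis)
    then show ?thesis
      unfolding set using val[OF elt_mem[OF i V]] label_elt[OF i V] ideals_coeff(2)[OF g i]
      by (simp add: finsum_insert)
  qed
qed

text \<open>
  After the previous lemma, the coefficient of the action on the span at \<open>t \<in> F w\<close> is literally the
  convolution that defines multiplication of polynomials.
\<close>

lemma to_span_smult:
  assumes p: "p \<in> carrier (mpoly_ring R r)" and g: "g \<in> carrier ideal_sum"
  shows "to_span (p \<odot>\<^bsub>ideal_sum\<^esub> g) = p \<odot>\<^bsub>span_mod\<^esub> to_span g"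
proof -
  have "(p \<odot>\<^bsub>ideal_sum\<^esub> g) (c w t) w = (\<Oplus>u\<in>{u. u \<le> w}. p u \<otimes>
      (\<Oplus>x\<in>{x \<in> F (w - u). T (w - u) w x = t \<and> to_span g (w - u) x \<noteq> \<zero>}. to_span g (w - u) x))"
    if w: "w \<in> expos r" and t: "t \<in> F w" for w t
  proof -
    have i: "c w t \<in> I" using label_mem[OF w t] by simp
    have "(p \<odot>\<^bsub>ideal_sum\<^esub> g) (c w t) w = (\<Oplus>u\<in>{u. u \<le> w}. p u \<otimes> g (c w t) (w - u))"
      using i by (simp add: smult_ideal_sum mpoly_mult_coeff[OF w])
    then show ?thesis
      by (simp add: transition_coeff[OF g expos_diff[OF w] w diff_le_expo t])
  qed
  then show ?thesis
    unfolding smult_span[OF p to_span_closed[OF g]]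
    by (simp add: to_span_def[of "p \<odot>\<^bsub>ideal_sum\<^esub> g"] cong: restrict_cong)
qed

lemma to_span_hom: "to_span \<in> graded_hom R r ideal_sum span_mod"
proof -
  have "to_span (f \<oplus>\<^bsub>ideal_sum\<^esub> g) = to_span f \<oplus>\<^bsub>span_mod\<^esub> to_span g" for f g
    using label_mem
    by (simp add: to_span_def add_span add_ideal_sum mpoly_ring_def cong: restrict_cong)
  moreover have "to_span ` piece ideal_sum v \<subseteq> piece span_mod v" for v
    using to_span_closed label_mem by (auto simp: piece_ideals piece_span) (simp add: to_span_def)
  ultimately show ?thesis
    using to_span_closed to_span_smult by (simp add: graded_hom_def)
qed

lemma ideal_sum_iso_span: "graded_iso R r ideal_sum span_mod"
proof (rule graded_isoI[OF to_span_hom])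
  show "to_ideals \<in> carrier span_mod \<rightarrow> carrier ideal_sum" using to_ideals_closed by blast
  show "to_ideals ` piece span_mod v \<subseteq> piece ideal_sum v" for v
  proof
    fix g assume "g \<in> to_ideals ` piece span_mod v"
    then obtain f where f: "f \<in> carrier span_mod" "g = to_ideals f"
      and 0: "\<And>w s. w \<in> expos r \<Longrightarrow> w \<noteq> v \<Longrightarrow> s \<in> F w \<Longrightarrow> f w s = \<zero>"
      by (auto simp: piece_span)
    have "g i w = \<zero>" if "i \<in> I" "w \<noteq> v" for i w
      using that 0 elt_mem V_expos by (auto simp: f(2) to_ideals_def)
    then show "g \<in> piece ideal_sum v" using to_ideals_closed[OF f(1)] f(2) by (simp add: piece_ideals)
  qed
qed (simp_all add: to_ideals_to_span to_span_to_ideals ideal_sum_add_closed ideal_sum_smult_closed)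

end


section \<open>The zero ring\<close>

text \<open>
  Over the zero ring distinct basis elements need not stay distinct in the module, so the index sets
  cannot be embedded into \<open>M\<close>. But then \<open>1 = 0\<close> acts as the identity on \<open>M\<close>, and \<open>M\<close> is zero.
\<close>

lemma zero_ring_iso_empty_sum:
  assumes R: "cring R" and M: "graded_module R r M" and triv: "\<one>\<^bsub>R\<^esub> = \<zero>\<^bsub>R\<^esub>"
  shows "graded_iso R r M (graded_direct_sum {} N)"
proof -
  interpret R: cring R by fact
  interpret M: module "mpoly_ring R r" M using M by (simp add: graded_module_def)
  have "\<one>\<^bsub>mpoly_ring R r\<^esub> = \<zero>\<^bsub>mpoly_ring R r\<^esub>" using triv by (auto simp: mpoly_ring_def)
  then have eq0: "x = \<zero>\<^bsub>M\<^esub>" if "x \<in> carrier M" for x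
    using M.smult_one[OF that] M.smult_l_null[OF that] by simp
  have "carrier (sum_group {} (\<lambda>i. add_monoid (N i))) = {\<lambda>_. undefined}"
    by (subst carrier_sum_group) auto
  then have sum: "carrier (graded_direct_sum {} N) = {\<lambda>_. undefined}"
    and piece: "piece (graded_direct_sum {} N) v = {\<lambda>_. undefined}" for v
    by (simp_all add: graded_direct_sum_def module.defs direct_sum_def)
  have hom: "(\<lambda>_ _. undefined) \<in> graded_hom R r M (graded_direct_sum {} N)"
    by (auto simp: graded_hom_def sum piece)
      (auto simp: graded_direct_sum_def module.defs direct_sum_def fun_eq_iff)
  show ?thesis
  proof (rule graded_isoI[OF hom, of "\<lambda>_. \<zero>\<^bsub>M\<^esub>"])
    fix v assume "v \<in> expos r"
    then have "subgroup (piece M v) (add_monoid M)" using M by (simp add: graded_module_def)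
    then have "\<zero>\<^bsub>M\<^esub> \<in> piece M v" by (auto dest: subgroup.one_closed)
    then show "(\<lambda>_. \<zero>\<^bsub>M\<^esub>) ` piece (graded_direct_sum {} N) v \<subseteq> piece M v" by auto
  qed (use eq0 in \<open>auto simp: sum\<close>)
qed


section \<open>From spans to sums of monomial ideals\<close>

text \<open>
  The components are the classes of linked elements, that is, the elements of the colimit of \<open>F\<close>. A
  class is named by the element of \<open>M\<close> that corresponds to a chosen representative of it; this is
  injective because \<open>1 \<noteq> 0\<close>.
\<close>

lemma span_imp_ideal_sum:
  fixes M :: "((nat \<Rightarrow> nat) \<Rightarrow> 'a, 'm) gmodule"
  assumes R: "cring R" and P: "cring (mpoly_ring R r)" and nontriv: "\<one>\<^bsub>R\<^esub> \<noteq> \<zero>\<^bsub>R\<^esub>"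
    and span: "iso_to_span TYPE('s) R r M"
  shows "iso_to_sum_of_monomial_ideals TYPE('m) R r M"
proof -
  interpret R: cring R by fact
  obtain F :: "(nat \<Rightarrow> nat) \<Rightarrow> 's set" and T
    where F: "multifiltration r F T" and iso: "graded_iso R r M (span_gmodule R r F T)"
    using span by (auto simp: iso_to_span_def)
  define E where "E = (SIGMA v:expos r. F v)"
  define basis where "basis = (\<lambda>(v, s). \<lambda>w\<in>expos r. \<lambda>t\<in>F w. if (w, t) = (v, s) then \<one>\<^bsub>R\<^esub> else \<zero>\<^bsub>R\<^esub>)"
  obtain \<phi> \<psi> where "\<psi> \<in> graded_hom R r (span_gmodule R r F T) M"
    and inv: "\<And>y. y \<in> carrier (span_gmodule R r F T) \<Longrightarrow> \<phi> (\<psi> y) = y"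
    using iso by (auto simp: graded_iso_def)
  have basis_closed: "basis x \<in> carrier (span_gmodule R r F T)" for x
  proof -
    have "finite {(v, s). v \<in> expos r \<and> s \<in> F v \<and> basis x v s \<noteq> \<zero>\<^bsub>R\<^esub>}"
      by (rule finite_subset[of _ "{x}"]) (auto simp: basis_def split: prod.splits if_splits)
    moreover have "basis x \<in> extensional (expos r)"
      "\<forall>v\<in>expos r. basis x v \<in> extensional (F v) \<and> (\<forall>s\<in>F v. basis x v s \<in> carrier R)"
      by (auto simp: basis_def split: prod.splits)
    ultimately show ?thesis by (simp add: R.carrier_span)
  qed
  have basis_inj: "x = y" if xy: "x \<in> E" "y \<in> E" "\<psi> (basis x) = \<psi> (basis y)" for x y
  proof -
    obtain v s where x: "x = (v, s)" "v \<in> expos r" "s \<in> F v" using xy(1) by (auto simp: E_def)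
    have "basis x = basis y" using inv[OF basis_closed] xy(3) by metis
    moreover have "basis x v s = \<one>\<^bsub>R\<^esub>" using x by (simp add: basis_def)
    ultimately have "basis y v s = \<one>\<^bsub>R\<^esub>" by simp
    then show ?thesis using nontriv x by (auto simp: basis_def split: prod.splits if_splits)
  qed
  have T_maps: "T v w s \<in> F w" if "v \<in> expos r" "w \<in> expos r" "v \<le> w" "s \<in> F v" for v w s
    using F that by (auto simp: multifiltration_def set_functor_def)
  have T_comp: "T v w (T u v s) = T u w s"
    if "u \<in> expos r" "v \<in> expos r" "w \<in> expos r" "u \<le> v" "v \<le> w" "s \<in> F u" for u v w s
    using F that by (auto simp: multifiltration_def set_functor_def)
  have T_inj: "s = t" if "v \<in> expos r" "w \<in> expos r" "v \<le> w" "s \<in> F v" "t \<in> F v" "T v w s = T v w t" for v w s t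
    using F that by (auto simp: multifiltration_def dest: inj_onD)
  (* Two common later degrees have a join, where the images can be compared: hence transitivity. *)
  define linked where "linked x y \<longleftrightarrow>
      (\<exists>w\<in>expos r. fst x \<le> w \<and> fst y \<le> w \<and> T (fst x) w (snd x) = T (fst y) w (snd y))" for x y
  have linked_refl: "linked x x" if "x \<in> E" for x
    using that by (auto simp: linked_def E_def)
  have linked_sym: "linked y x" if "linked x y" for x y
    using that by (auto simp: linked_def)
  have linked_trans: "linked x z" if xyz: "x \<in> E" "y \<in> E" "z \<in> E" and xy: "linked x y" and yz: "linked y z" for x y z
  proof -
    obtain u where u: "u \<in> expos r" "fst x \<le> u" "fst y \<le> u" "T (fst x) u (snd x) = T (fst y) u (snd y)"
      using xy by (auto simp: linked_def)
    obtain v where v: "v \<in> expos r" "fst y \<le> v" "fst z \<le> v" "T (fst y) v (snd y) = T (fst z) v (snd z)"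
      using yz by (auto simp: linked_def)
    have E: "fst x \<in> expos r" "snd x \<in> F (fst x)" "fst y \<in> expos r" "snd y \<in> F (fst y)"
      "fst z \<in> expos r" "snd z \<in> F (fst z)"
      using xyz by (auto simp: E_def)
    let ?w = "sup u v"
    have w: "?w \<in> expos r" using u v by (simp add: expos_sup)
    have "T (fst x) ?w (snd x) = T u ?w (T (fst x) u (snd x))"
      using E u w by (intro T_comp[symmetric]) auto
    also have "\<dots> = T u ?w (T (fst y) u (snd y))" using u by simp
    also have "\<dots> = T (fst y) ?w (snd y)" using E u w by (intro T_comp) auto
    also have "\<dots> = T v ?w (T (fst y) v (snd y))"
      using E v w by (intro T_comp[symmetric]) auto
    also have "\<dots> = T v ?w (T (fst z) v (snd z))" using v by simp
    also have "\<dots> = T (fst z) ?w (snd z)" using E v w by (intro T_comp) auto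
    finally show ?thesis using w u v unfolding linked_def
      by (meson le_supI1 le_supI2)
  qed
  (* Linked elements satisfy the same predicate, so the choice depends on the class only. *)
  define rep where "rep x = (SOME y. y \<in> E \<and> linked x y)" for x
  have rep: "rep x \<in> E \<and> linked x (rep x)" if "x \<in> E" for x
    unfolding rep_def by (rule someI[of _ x]) (use that linked_refl in auto)
  have rep_eq: "rep x = rep y" if "x \<in> E" "y \<in> E" "linked x y" for x y
  proof -
    have "(z \<in> E \<and> linked x z) = (z \<in> E \<and> linked y z)" for z
      using that linked_trans linked_sym by blast
    then show ?thesis by (simp add: rep_def)
  qed
  define c where "c v s = \<psi> (basis (rep (v, s)))" for v s
  define I where "I = {c v s | v s. (v, s) \<in> E}"
  define V where "V i = {v \<in> expos r. \<exists>s\<in>F v. c v s = i}" for i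
  have c_eq_iff: "c v s = c w t \<longleftrightarrow> linked (v, s) (w, t)" if "(v, s) \<in> E" "(w, t) \<in> E" for v s w t
  proof
    assume "c v s = c w t"
    then have "rep (v, s) = rep (w, t)" using basis_inj rep that by (simp add: c_def)
    then show "linked (v, s) (w, t)" using rep that linked_trans linked_sym by metis
  next
    assume "linked (v, s) (w, t)"
    then show "c v s = c w t" using rep_eq that by (simp add: c_def)
  qed
  have c_T: "c w (T v w s) = c v s" if vw: "v \<in> expos r" "w \<in> expos r" "v \<le> w" "s \<in> F v" for v w s
  proof -
    have Ts: "T v w s \<in> F w" using vw by (rule T_maps)
    have "T w w (T v w s) = T v w s" using vw by (intro T_comp) auto
    then have "linked (w, T v w s) (v, s)" using vw by (auto simp: linked_def)
    then show ?thesis using c_eq_iff vw Ts by (simp add: E_def)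
  qed
  interpret labelled_functor R r F T I V c
  proof (intro labelled_functor.intro labelled_functor_axioms.intro R)
    show "cring (mpoly_ring R r)" by fact
    show "T v w \<in> F v \<rightarrow> F w" if "v \<in> expos r" "w \<in> expos r" "v \<le> w" for v w
      using T_maps that by blast
    show "upset r (V i)" for i
      unfolding upset_def V_def using T_maps c_T by blast
    show "c w (T v w s) = c v s" if "v \<in> expos r" "w \<in> expos r" "v \<le> w" "s \<in> F v" for v w s
      using c_T that .
    show "bij_betw (c v) (F v) {i \<in> I. v \<in> V i}" if v: "v \<in> expos r" for v
    proof (rule bij_betw_imageI)
      (* Linked elements of the same degree agree because the transition maps are injective. *)
      show "inj_on (c v) (F v)"
      proof (rule inj_onI)
        fix s t assume st: "s \<in> F v" "t \<in> F v" "c v s = c v t"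
        then have "linked (v, s) (v, t)" using c_eq_iff v by (simp add: E_def)
        then obtain w where "w \<in> expos r" "v \<le> w" "T v w s = T v w t" by (auto simp: linked_def)
        then show "s = t" using T_inj v st by blast
      qed
      show "c v ` F v = {i \<in> I. v \<in> V i}"
        using v by (auto simp: I_def V_def E_def)
    qed
  qed
  have "graded_iso R r M ideal_sum"
    using graded_iso_trans[OF iso graded_iso_sym[OF ideal_sum_iso_span]] .
  moreover have "\<forall>i\<in>I. monomial_ideal R r (support_ideal R r (V i))"
    using V_upset monomial_ideal_iff[OF R P] by blast
  ultimately show ?thesis unfolding iso_to_sum_of_monomial_ideals_def
    by (intro exI[of _ I] exI[of _ "\<lambda>i. support_ideal R r (V i)"] conjI)
qed


section \<open>From sums of monomial ideals to spans\<close>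

text \<open>
  A description of the summands as support ideals is available only for indices in \<open>I\<close>.
\<close>

lemma graded_direct_sum_cong:
  assumes "\<And>i. i \<in> I \<Longrightarrow> N i = N' i"
  shows "graded_direct_sum I N = graded_direct_sum I N'"
proof -
  have "product_group I (\<lambda>i. add_monoid (N i)) = product_group I (\<lambda>i. add_monoid (N' i))"
    using assms by (auto simp: product_group_def fun_eq_iff cong: PiE_cong)
  moreover have "{x \<in> \<Pi>\<^sub>E i\<in>I. carrier (add_monoid (N i)). finite {i \<in> I. x i \<noteq> \<one>\<^bsub>add_monoid (N i)\<^esub>}} =
      {x \<in> \<Pi>\<^sub>E i\<in>I. carrier (add_monoid (N' i)). finite {i \<in> I. x i \<noteq> \<one>\<^bsub>add_monoid (N' i)\<^esub>}}"
    using assms by (simp cong: PiE_cong conj_cong)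
  ultimately have "sum_group I (\<lambda>i. add_monoid (N i)) = sum_group I (\<lambda>i. add_monoid (N' i))"
    unfolding sum_group_def by argo
  moreover have "(\<lambda>a f. \<lambda>i\<in>I. a \<odot>\<^bsub>N i\<^esub> f i) = (\<lambda>a f. \<lambda>i\<in>I. a \<odot>\<^bsub>N' i\<^esub> f i)"
    using assms by (auto simp: fun_eq_iff)
  ultimately have "direct_sum I N = direct_sum I N'"
    unfolding direct_sum_def by simp
  then show ?thesis using assms unfolding graded_direct_sum_def by simp
qed

text \<open>
  The \<open>i\<close>-th summand is named by the element of \<open>M\<close> that corresponds to some monomial in it. Zero
  summands contain no monomial, but they contribute to no set \<open>F v\<close> either.
\<close>

lemma ideal_sum_imp_span:
  fixes M :: "((nat \<Rightarrow> nat) \<Rightarrow> 'a, 'm) gmodule"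
  assumes R: "cring R" and P: "cring (mpoly_ring R r)" and nontriv: "\<one>\<^bsub>R\<^esub> \<noteq> \<zero>\<^bsub>R\<^esub>"
    and sum: "iso_to_sum_of_monomial_ideals TYPE('i) R r M"
  shows "iso_to_span TYPE('m) R r M"
proof -
  interpret R: cring R by fact
  obtain I :: "'i set" and J where J: "\<And>i. i \<in> I \<Longrightarrow> monomial_ideal R r (J i)"
    and iso: "graded_iso R r M (graded_direct_sum I (\<lambda>i. ideal_gmodule R r (J i)))"
    using sum by (auto simp: iso_to_sum_of_monomial_ideals_def)
  obtain V where V: "\<And>i. i \<in> I \<Longrightarrow> upset r (V i)" and JV: "\<And>i. i \<in> I \<Longrightarrow> J i = support_ideal R r (V i)"
  proof -
    have "\<forall>i\<in>I. \<exists>U. upset r U \<and> J i = support_ideal R r U"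
      using J by (simp add: monomial_ideal_iff[OF R P])
    then show ?thesis using that by (auto dest!: bchoice)
  qed
  let ?N = "graded_direct_sum I (\<lambda>i. ideal_gmodule R r (support_ideal R r (V i)))"
  have "graded_direct_sum I (\<lambda>i. ideal_gmodule R r (J i)) = ?N"
    by (rule graded_direct_sum_cong) (simp add: JV)
  then have iso: "graded_iso R r M ?N" using iso by simp
  obtain \<phi> \<psi> where "\<psi> \<in> graded_hom R r ?N M" and inv: "\<And>y. y \<in> carrier ?N \<Longrightarrow> \<phi> (\<psi> y) = y"
    using iso by (auto simp: graded_iso_def)
  define I' where "I' = {i \<in> I. V i \<noteq> {}}"
  define gen where "gen i = (\<lambda>j\<in>I. if j = i then monomial R (SOME v. v \<in> V i) else (\<lambda>_. \<zero>\<^bsub>R\<^esub>))" for i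
  have gen_closed: "gen i \<in> carrier ?N" if i: "i \<in> I'" for i
  proof -
    define v where "v = (SOME v. v \<in> V i)"
    have v: "v \<in> V i" unfolding v_def using i by (simp add: I'_def some_in_eq)
    have iI: "i \<in> I" using i by (simp add: I'_def)
    have ve: "v \<in> expos r" using V[OF iI] v by (auto simp: upset_def)
    have "finite {(j, w). j \<in> I \<and> gen i j w \<noteq> \<zero>\<^bsub>R\<^esub>}"
      by (rule finite_subset[of _ "{(i, v)}"]) (auto simp: gen_def v_def monomial_def split: if_splits)
    moreover have "gen i j \<in> support_ideal R r (V j)" if "j \<in> I" for j
      using that v ve by (auto simp: gen_def v_def[symmetric] support_ideal_def monomial_def mpoly_ring_def)
    ultimately show ?thesis by (simp add: R.carrier_ideal_sum[of r I V, OF P V] gen_def)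
  qed
  have inj: "inj_on (\<lambda>i. \<psi> (gen i)) I'"
  proof (rule inj_onI)
    fix i j assume ij: "i \<in> I'" "j \<in> I'" "\<psi> (gen i) = \<psi> (gen j)"
    then have "gen i = gen j" using inv gen_closed by metis
    moreover have "gen i i (SOME v. v \<in> V i) = \<one>\<^bsub>R\<^esub>"
      using ij(1) by (simp add: gen_def monomial_def I'_def)
    moreover have "gen j i v = \<zero>\<^bsub>R\<^esub>" if "i \<noteq> j" for v
      using that ij(1) by (simp add: gen_def I'_def)
    ultimately show "i = j" using nontriv by metis
  qed
  define F where "F v = (\<lambda>i. \<psi> (gen i)) ` {i \<in> I. v \<in> V i}" for v
  define T where "T = (\<lambda>(v :: nat \<Rightarrow> nat) (w :: nat \<Rightarrow> nat) (s :: 'm). s)"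
  define c where "c = (\<lambda>v :: nat \<Rightarrow> nat. inv_into I' (\<lambda>i. \<psi> (gen i)))"
  have mono: "F v \<subseteq> F w" if "v \<in> expos r" "w \<in> expos r" "v \<le> w" for v w
    using V that by (auto simp: F_def upset_def)
  have sub: "{i \<in> I. v \<in> V i} \<subseteq> I'" for v by (auto simp: I'_def)
  have name: "inv_into I' (\<lambda>i. \<psi> (gen i)) (\<psi> (gen i)) = i" if "i \<in> I'" for i
    using inv_into_f_f[OF inj that] by simp
  interpret labelled_functor R r F T I V c
  proof (intro labelled_functor.intro labelled_functor_axioms.intro R)
    show "cring (mpoly_ring R r)" by fact
    show "T v w \<in> F v \<rightarrow> F w" if "v \<in> expos r" "w \<in> expos r" "v \<le> w" for v w
      using mono[OF that] by (auto simp: T_def)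
    show "upset r (V i)" if "i \<in> I" for i using V that .
    show "c w (T v w s) = c v s" for v w s by (simp add: c_def T_def)
    show "bij_betw (c v) (F v) {i \<in> I. v \<in> V i}" for v
      unfolding c_def F_def
      by (rule bij_betw_byWitness[where f' = "\<lambda>i. \<psi> (gen i)"])
        (use sub[of v] in \<open>auto simp: name subset_iff\<close>)
  qed
  have "multifiltration r F T"
    using mono unfolding multifiltration_def set_functor_def by (auto simp: T_def)
  then show ?thesis
    using graded_iso_trans[OF iso ideal_sum_iso_span] unfolding iso_to_span_def
    by (intro exI[of _ F] exI[of _ T] conjI)
qed


section \<open>The equivalence\<close>

theorem mainTheorem1:
  fixes R :: "('a, 'z) ring_scheme" and r :: nat
    and M :: "((nat \<Rightarrow> nat) \<Rightarrow> 'a, 'm) gmodule"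
  assumes "cring R" and "graded_module R r M"
  shows "(iso_to_span TYPE('m) R r M \<longleftrightarrow> iso_to_sum_of_monomial_ideals TYPE('m) R r M) \<and>
         (iso_to_span TYPE('s) R r M \<longrightarrow> iso_to_span TYPE('m) R r M) \<and>
         (iso_to_sum_of_monomial_ideals TYPE('i) R r M \<longrightarrow>
            iso_to_sum_of_monomial_ideals TYPE('m) R r M)"
proof (cases "\<one>\<^bsub>R\<^esub> = \<zero>\<^bsub>R\<^esub>")
  case True
  interpret cring R by fact
  have P: "cring (mpoly_ring R r)"
    using assms(2) by (simp add: graded_module_def module_def)
  let ?J = "\<lambda>_ :: 'm. support_ideal R r {}"
  have iso: "graded_iso R r M (graded_direct_sum {} (\<lambda>i :: 'm. ideal_gmodule R r (?J i)))"
    using zero_ring_iso_empty_sum[OF assms True] .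
  interpret labelled_functor R r "\<lambda>_. {} :: 'm set" "\<lambda>_ _ s. s" "{} :: 'm set" "\<lambda>_. {}" "\<lambda>_ s. s"
    by (intro labelled_functor.intro labelled_functor_axioms.intro cring_axioms P)
      (auto simp: bij_betw_def)
  have "multifiltration r (\<lambda>_. {} :: 'm set) (\<lambda>_ _ s. s)"
    by (simp add: multifiltration_def set_functor_def)
  then have "iso_to_span TYPE('m) R r M"
    using graded_iso_trans[OF iso ideal_sum_iso_span] unfolding iso_to_span_def by blast
  moreover have "iso_to_sum_of_monomial_ideals TYPE('m) R r M"
    using iso unfolding iso_to_sum_of_monomial_ideals_def
    by (intro exI[of _ "{}"] exI[of _ ?J]) simp
  ultimately show ?thesis by blast
next
  case False
  have P: "cring (mpoly_ring R r)"
    using assms(2) by (simp add: graded_module_def module_def)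
  show ?thesis
    using span_imp_ideal_sum[OF assms(1) P False, where ?'s = 's]
      span_imp_ideal_sum[OF assms(1) P False, where ?'s = 'm]
      ideal_sum_imp_span[OF assms(1) P False, where ?'i = 'i]
      ideal_sum_imp_span[OF assms(1) P False, where ?'i = 'm]
    by blast
qed

end
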